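(* The space of bounded vectors in $\mathfrak{g}=\mathrm{Lie}(G)$ for a Riemannian homogeneous space $G/H$ on which the connected Lie group $G$ acts effectively does not depend on the choice of $H$. That is: if $G$ is a connected Lie group and $H_1,H_2$ are closed subgroups of $G$ such that, for $i=1,2$, $G/H_i$ is a Riemannian homogeneous space on which $G$ acts effectively, then a vector $X\in\mathfrak{g}$ is bounded for $G/H_1$ if and only if it is bounded for $G/H_2$.
   Context: A Riemannian homogeneous space $G/H$ is a coset space, $H$ a closed subgroup of $G$ with Lie algebra $\mathfrak{h}$, endowed with a $G$-invariant Riemannian metric. A vector $X\in\mathfrak{g}$ is a bounded vector for $G/H$ if the function $g\mapsto\|\mathrm{pr}_{\mathfrak{g}/\mathfrak{h}}(\mathrm{Ad}(g)X)\|$ is bounded on $G$, where $\mathrm{pr}_{\mathfrak{g}/\mathfrak{h}}:\mathfrak{g}\to\mathfrak{g}/\mathfrak{h}$ is the natural projection and $\|\cdot\|$ is any norm on $\mathfrak{g}/\mathfrak{h}$ (the choice of norm is irrelevant). *)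

theory Defs
  imports
    "HOL-Analysis.Analysis"
    "HOL-Algebra.Left_Coset"
    "HOL-Algebra.Group_Action"
begin

section \<open>Smooth manifolds\<close>

text \<open>
  The model spaces are the library's \<^const>\<open>Euclidean_space\<close> \<open>n\<close>, i.e. \<open>\<real>\<^sup>n\<close> as the space of
  all \<open>x :: nat \<Rightarrow> real\<close> with \<open>x i = 0\<close> for \<open>i \<ge> n\<close>. Since \<open>n\<close> is a term, the dimension
  of \<open>G/H\<close> need not be reflected in a type, and dimension 0 is included.
\<close>

definition partial_deriv :: "nat \<Rightarrow> ((nat \<Rightarrow> real) \<Rightarrow> real) \<Rightarrow> (nat \<Rightarrow> real) \<Rightarrow> real" where
  "partial_deriv i f x = deriv (\<lambda>t. f (x(i := t))) (x i)"

text \<open>\<open>Ck_on n k W f\<close>: all iterated partial derivatives of \<open>f\<close> of order \<open>\<le> k\<close> exist and are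
  continuous on \<open>W\<close>, which is meant to be an open subset of \<open>\<real>\<^sup>n\<close>.\<close>

primrec Ck_on :: "nat \<Rightarrow> nat \<Rightarrow> (nat \<Rightarrow> real) set \<Rightarrow> ((nat \<Rightarrow> real) \<Rightarrow> real) \<Rightarrow> bool" where
  "Ck_on n 0 W f \<longleftrightarrow> continuous_map (subtopology (Euclidean_space n) W) euclideanreal f"
| "Ck_on n (Suc k) W f \<longleftrightarrow>
     continuous_map (subtopology (Euclidean_space n) W) euclideanreal f \<and>
     (\<forall>i<n. (\<forall>x\<in>W. (\<lambda>t. f (x(i := t))) differentiable (at (x i))) \<and>
            Ck_on n k W (partial_deriv i f))"

definition smooth_on :: "nat \<Rightarrow> (nat \<Rightarrow> real) set \<Rightarrow> ((nat \<Rightarrow> real) \<Rightarrow> real) \<Rightarrow> bool" where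
  "smooth_on n W f \<longleftrightarrow> (\<forall>k. Ck_on n k W f)"

type_synonym 'a chart = "'a set \<times> ('a \<Rightarrow> nat \<Rightarrow> real)"

record 'a manifold =
  mtop :: "'a topology"
  mdim :: nat
  charts :: "'a chart set"

locale smooth_manifold =
  fixes M :: "'a manifold"
  assumes Hausdorff: "Hausdorff_space (mtop M)"
    and second_countable: "second_countable (mtop M)"
    and chart_domain: "(U, \<phi>) \<in> charts M \<Longrightarrow> openin (mtop M) U"
    and chart_range: "(U, \<phi>) \<in> charts M \<Longrightarrow> openin (Euclidean_space (mdim M)) (\<phi> ` U)"
    and chart_homeomorphic: "(U, \<phi>) \<in> charts M \<Longrightarrow>
      homeomorphic_map (subtopology (mtop M) U) (subtopology (Euclidean_space (mdim M)) (\<phi> ` U)) \<phi>"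
    and charts_cover: "(\<Union>(U, \<phi>)\<in>charts M. U) = topspace (mtop M)"
    and charts_compatible: "\<lbrakk>(U, \<phi>) \<in> charts M; (V, \<psi>) \<in> charts M; j < mdim M\<rbrakk> \<Longrightarrow>
      smooth_on (mdim M) (\<phi> ` (U \<inter> V)) (\<lambda>x. \<psi> (inv_into U \<phi> x) j)"

definition smooth_map :: "'a manifold \<Rightarrow> 'b manifold \<Rightarrow> ('a \<Rightarrow> 'b) \<Rightarrow> bool" where
  "smooth_map M N F \<longleftrightarrow>
     continuous_map (mtop M) (mtop N) F \<and>
     (\<forall>(U, \<phi>)\<in>charts M. \<forall>(V, \<psi>)\<in>charts N. \<forall>j<mdim N.
        smooth_on (mdim M) (\<phi> ` {p \<in> U. F p \<in> V}) (\<lambda>x. \<psi> (F (inv_into U \<phi> x)) j))"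

definition prod_manifold :: "'a manifold \<Rightarrow> 'b manifold \<Rightarrow> ('a \<times> 'b) manifold" where
  "prod_manifold M N =
     \<lparr>mtop = prod_topology (mtop M) (mtop N),
      mdim = mdim M + mdim N,
      charts = (\<lambda>((U, \<phi>), (V, \<psi>)).
                  (U \<times> V, \<lambda>(p, q) i. if i < mdim M then \<phi> p i else \<psi> q (i - mdim M)))
               ` (charts M \<times> charts N)\<rparr>"

definition real_line :: "real manifold" where
  "real_line = \<lparr>mtop = euclideanreal, mdim = 1, charts = {(UNIV, \<lambda>t i. if i = 0 then t else 0)}\<rparr>"


section \<open>Tangent vectors\<close>

definition smooth_near :: "'a manifold \<Rightarrow> 'a \<Rightarrow> ('a \<Rightarrow> real) \<Rightarrow> bool" where
  "smooth_near M p f \<longleftrightarrow>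
     (\<exists>W. p \<in> W \<and> openin (mtop M) W \<and>
        (\<forall>(U, \<phi>)\<in>charts M. smooth_on (mdim M) (\<phi> ` (U \<inter> W)) (\<lambda>x. f (inv_into U \<phi> x))))"

text \<open>
  A tangent vector at \<open>p\<close> is the velocity of a smooth curve through \<open>p\<close>, i.e. the derivation
  \<open>f \<mapsto> (f \<circ> \<gamma>)'(0)\<close> on the functions that are smooth near \<open>p\<close>. It is set to 0 on all other
  functions, so that equality of tangent vectors is equality of functionals. The vector space
  operations are the pointwise ones.
\<close>

type_synonym 'a tangent_vector = "('a \<Rightarrow> real) \<Rightarrow> real"

definition velocity :: "'a manifold \<Rightarrow> (real \<Rightarrow> 'a) \<Rightarrow> 'a tangent_vector" where
  "velocity M \<gamma> f = (if smooth_near M (\<gamma> 0) f then deriv (\<lambda>t. f (\<gamma> t)) 0 else 0)"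

definition tangent_space :: "'a manifold \<Rightarrow> 'a \<Rightarrow> 'a tangent_vector set" where
  "tangent_space M p = {velocity M \<gamma> | \<gamma>. smooth_map real_line M \<gamma> \<and> \<gamma> 0 = p}"

text \<open>\<open>differential N F p\<close> is \<open>dF\<^sub>p\<close> for a smooth map \<open>F\<close> into \<open>N\<close>.\<close>

definition differential ::
    "'b manifold \<Rightarrow> ('a \<Rightarrow> 'b) \<Rightarrow> 'a \<Rightarrow> 'a tangent_vector \<Rightarrow> 'b tangent_vector" where
  "differential N F p v f = (if smooth_near N (F p) f then v (\<lambda>q. f (F q)) else 0)"

text \<open>The coordinate vector \<open>\<partial>/\<partial>\<phi>\<^sub>i\<close> at \<open>p\<close>.\<close>

definition coordinate_vector ::
    "'a manifold \<Rightarrow> 'a chart \<Rightarrow> nat \<Rightarrow> 'a \<Rightarrow> 'a tangent_vector" where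
  "coordinate_vector M c i p f =
     (case c of (U, \<phi>) \<Rightarrow>
        if smooth_near M p f then partial_deriv i (\<lambda>x. f (inv_into U \<phi> x)) (\<phi> p) else 0)"

type_synonym 'a metric_tensor = "'a \<Rightarrow> 'a tangent_vector \<Rightarrow> 'a tangent_vector \<Rightarrow> real"

definition riemannian_metric :: "'a manifold \<Rightarrow> 'a metric_tensor \<Rightarrow> bool" where
  "riemannian_metric M m \<longleftrightarrow>
     (\<forall>p\<in>topspace (mtop M). \<forall>u\<in>tangent_space M p. \<forall>v\<in>tangent_space M p.
        m p u v = m p v u \<and>
        (\<forall>w\<in>tangent_space M p. \<forall>a b. m p (\<lambda>f. a * u f + b * v f) w = a * m p u w + b * m p v w) \<and>
        (u \<noteq> (\<lambda>f. 0) \<longrightarrow> m p u u > 0)) \<and>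
     (\<forall>(U, \<phi>)\<in>charts M. \<forall>i<mdim M. \<forall>j<mdim M.
        smooth_on (mdim M) (\<phi> ` U)
          (\<lambda>x. let p = inv_into U \<phi> x
               in m p (coordinate_vector M (U, \<phi>) i p) (coordinate_vector M (U, \<phi>) j p)))"


section \<open>Lie groups\<close>

locale lie_group = group G + smooth_manifold M
  for G :: "('a, 'b) monoid_scheme" (structure) and M :: "'a manifold" +
  assumes carrier_eq: "topspace (mtop M) = carrier G"
    and smooth_mult: "smooth_map (prod_manifold M M) M (\<lambda>(x, y). x \<otimes> y)"
    and smooth_inv: "smooth_map M M (\<lambda>x. inv x)"

definition lie_algebra :: "('a, 'b) monoid_scheme \<Rightarrow> 'a manifold \<Rightarrow> 'a tangent_vector set" where
  "lie_algebra G M = tangent_space M \<one>\<^bsub>G\<^esub>"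

definition Ad ::
    "('a, 'b) monoid_scheme \<Rightarrow> 'a manifold \<Rightarrow> 'a \<Rightarrow> 'a tangent_vector \<Rightarrow> 'a tangent_vector" where
  "Ad G M g = differential M (\<lambda>x. g \<otimes>\<^bsub>G\<^esub> x \<otimes>\<^bsub>G\<^esub> inv\<^bsub>G\<^esub> g) \<one>\<^bsub>G\<^esub>"

text \<open>
  The Lie algebra of a closed subgroup \<open>H\<close>, as a subspace of that of \<open>G\<close>. A closed subgroup is an
  embedded submanifold, so the smooth curves of \<open>H\<close> are the smooth curves of \<open>G\<close> with values in
  \<open>H\<close>, and this is the image of the tangent space of \<open>H\<close> at the identity.
\<close>

definition lie_subalgebra ::
    "('a, 'b) monoid_scheme \<Rightarrow> 'a manifold \<Rightarrow> 'a set \<Rightarrow> 'a tangent_vector set" where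
  "lie_subalgebra G M H =
     {velocity M \<gamma> | \<gamma>. smooth_map real_line M \<gamma> \<and> \<gamma> 0 = \<one>\<^bsub>G\<^esub> \<and> range \<gamma> \<subseteq> H}"


section \<open>Riemannian homogeneous spaces\<close>

text \<open>
  \<open>N\<close> is the smooth manifold \<open>G/H\<close> of left cosets: its smooth structure is the one, unique up to
  the choice of an atlas, that makes the projection a smooth submersion. As submersions are open
  maps, its topology is then the quotient topology.
\<close>

definition homogeneous_manifold ::
    "('a, 'b) monoid_scheme \<Rightarrow> 'a manifold \<Rightarrow> 'a set \<Rightarrow> 'a set manifold \<Rightarrow> bool" where
  "homogeneous_manifold G M H N \<longleftrightarrow>
     smooth_manifold N \<and>
     topspace (mtop N) = lcosets\<^bsub>G\<^esub> H \<and>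
     smooth_map M N (\<lambda>a. a <#\<^bsub>G\<^esub> H) \<and>
     (\<forall>a\<in>carrier G. differential N (\<lambda>x. x <#\<^bsub>G\<^esub> H) a ` tangent_space M a
                     = tangent_space N (a <#\<^bsub>G\<^esub> H))"

definition invariant_metric ::
    "('a, 'b) monoid_scheme \<Rightarrow> 'a set manifold \<Rightarrow> 'a set metric_tensor \<Rightarrow> bool" where
  "invariant_metric G N m \<longleftrightarrow>
     (\<forall>g\<in>carrier G. \<forall>C\<in>topspace (mtop N). \<forall>u\<in>tangent_space N C. \<forall>v\<in>tangent_space N C.
        m (g <#\<^bsub>G\<^esub> C) (differential N (\<lambda>D. g <#\<^bsub>G\<^esub> D) C u) (differential N (\<lambda>D. g <#\<^bsub>G\<^esub> D) C v)
          = m C u v)"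

definition riemannian_homogeneous_space ::
    "('a, 'b) monoid_scheme \<Rightarrow> 'a manifold \<Rightarrow> 'a set \<Rightarrow> 'a set manifold \<Rightarrow> 'a set metric_tensor \<Rightarrow> bool"
  where
  "riemannian_homogeneous_space G M H N m \<longleftrightarrow>
     subgroup H G \<and> closedin (mtop M) H \<and>
     homogeneous_manifold G M H N \<and> riemannian_metric N m \<and> invariant_metric G N m"

definition acts_effectively :: "('a, 'b) monoid_scheme \<Rightarrow> 'a set \<Rightarrow> bool" where
  "acts_effectively G H \<longleftrightarrow>
     faithful_action G (lcosets\<^bsub>G\<^esub> H) (\<lambda>g. \<lambda>C\<in>lcosets\<^bsub>G\<^esub> H. g <#\<^bsub>G\<^esub> C)"


section \<open>Bounded vectors\<close>

text \<open>The projection onto the quotient by the Lie algebra of \<open>H\<close>, whose elements are the cosets of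
  that subspace.\<close>

definition quotient_proj ::
    "('a, 'b) monoid_scheme \<Rightarrow> 'a manifold \<Rightarrow> 'a set \<Rightarrow> 'a tangent_vector \<Rightarrow> 'a tangent_vector set"
  where
  "quotient_proj G M H X = {\<lambda>f. X f + Y f | Y. Y \<in> lie_subalgebra G M H}"

definition quotient_norm ::
    "('a, 'b) monoid_scheme \<Rightarrow> 'a manifold \<Rightarrow> 'a set \<Rightarrow> ('a tangent_vector set \<Rightarrow> real) \<Rightarrow> bool" where
  "quotient_norm G M H \<nu> \<longleftrightarrow>
     (\<forall>X\<in>lie_algebra G M.
        \<nu> (quotient_proj G M H X) \<ge> 0 \<and>
        (\<nu> (quotient_proj G M H X) = 0 \<longrightarrow> quotient_proj G M H X = quotient_proj G M H (\<lambda>f. 0)) \<and>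
        (\<forall>a. \<nu> (quotient_proj G M H (\<lambda>f. a * X f)) = \<bar>a\<bar> * \<nu> (quotient_proj G M H X)) \<and>
        (\<forall>Y\<in>lie_algebra G M. \<nu> (quotient_proj G M H (\<lambda>f. X f + Y f))
           \<le> \<nu> (quotient_proj G M H X) + \<nu> (quotient_proj G M H Y)))"

definition bounded_vectors ::
    "('a, 'b) monoid_scheme \<Rightarrow> 'a manifold \<Rightarrow> 'a set \<Rightarrow> ('a tangent_vector set \<Rightarrow> real) \<Rightarrow>
      'a tangent_vector set" where
  "bounded_vectors G M H \<nu> =
     {X \<in> lie_algebra G M. bounded ((\<lambda>g. \<nu> (quotient_proj G M H (Ad G M g X))) ` carrier G)}"

end

theory Submission
  imports Defs
begin

text \<open>
  A vector \<open>X\<close> is bounded for \<open>G/H\<close> exactly when its adjoint orbit \<open>Ad(G)X\<close> is a bounded subset of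
  the finite-dimensional space \<open>\<g>\<close>, a condition that does not mention \<open>H\<close>
  (\<open>bounded_vectors_iff_orbit_bounded\<close>). One direction is clear, since the projection to \<open>\<g>/\<h>\<close>
  followed by a norm is a seminorm on \<open>\<g>\<close> and so is bounded on bounded sets.

  For the other direction, let \<open>B\<close> be the space of bounded vectors and let \<open>p(X)\<close> be the supremum over \<open>g\<close>
  of the norm of the projection of \<open>Ad(g)X\<close>. This is an \<open>Ad(G)\<close>-invariant seminorm on \<open>B\<close>. If \<open>p(X) = 0\<close>,
  then \<open>Ad(g)X\<close> lies in \<open>\<h>\<close> for all \<open>g\<close>, so the one-parameter group of \<open>X\<close> lies in every conjugate of
  \<open>H\<close> and acts trivially on \<open>G/H\<close>; as the action is effective, \<open>X = 0\<close>. Thus \<open>p\<close> is a norm on \<open>B\<close>.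
  All norms on \<open>B\<close> are equivalent, and \<open>p\<close> is constant on adjoint orbits, so these orbits are bounded.

  In place of the exponential map a weaker statement is proved (\<open>common_power_limit\<close>): a nonzero \<open>X\<close> determines
  an element \<open>x \<noteq> \<one>\<close> and sequences \<open>s\<^sub>k\<close>, \<open>m\<^sub>k\<close> such that the \<open>m\<^sub>k\<close>-th powers of \<open>\<beta>(s\<^sub>k)\<close> tend to
  \<open>x\<close> for all smooth curves \<open>\<beta>\<close> with velocity \<open>X\<close> at \<open>\<one>\<close>. Applied to curves in the conjugates of the closed
  group \<open>H\<close>, all with velocity \<open>X\<close>, it puts \<open>x\<close> into all of them. The estimates for powers rest on one
  fact of calculus (\<open>mult_strict_derivative\<close>): in a chart at the identity, multiplication is strictly
  differentiable with derivative \<open>(a, b) \<mapsto> a + b\<close>.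
\<close>

section \<open>Calculus on open subsets of Euclidean space\<close>

lemma fun_upd_in_Euclidean_space:
  "\<lbrakk>x \<in> topspace (Euclidean_space n); i < n\<rbrakk> \<Longrightarrow> x(i := t) \<in> topspace (Euclidean_space n)"
  by (auto simp: topspace_Euclidean_space)

lemma continuous_map_Euclidean_space_coordinate:
  "continuous_map (Euclidean_space n) euclideanreal (\<lambda>x. x i)"
  unfolding Euclidean_space_def
  by (intro continuous_map_from_subtopology continuous_map_product_projection) auto

text \<open>
  Points of \<open>\<real>\<^sup>n\<close> vanish beyond the first \<open>n\<close> coordinates, so a condition on these
  coordinates alone describes a neighbourhood.
\<close>

lemma openin_Euclidean_space_box:
  assumes W: "openin (Euclidean_space n) W" and p: "p \<in> W"
  obtains d where "d > 0"
    "\<forall>x\<in>topspace (Euclidean_space n). (\<forall>i<n. \<bar>x i - p i\<bar> < d) \<longrightarrow> x \<in> W"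
proof -
  obtain T where T: "openin (powertop_real UNIV) T" and WT: "W = T \<inter> {x. \<forall>i\<ge>n. x i = 0}"
    using W by (auto simp: Euclidean_space_def openin_subtopology)
  have "p \<in> T" using p WT by blast
  then obtain U where U: "\<forall>i\<in>UNIV. openin euclideanreal (U i)" "p \<in> Pi\<^sub>E UNIV U" "Pi\<^sub>E UNIV U \<subseteq> T"
    using T unfolding openin_product_topology_alt by blast
  have "\<exists>e>0. ball (p i) e \<subseteq> U i" for i
    using U(1,2) open_contains_ball[of "U i"] by (auto simp: PiE_UNIV_domain)
  then obtain e where e: "\<And>i. e i > 0" "\<And>i. ball (p i) (e i) \<subseteq> U i" by metis
  define d where "d = Min (insert 1 (e ` {..<n}))"
  have d: "d > 0" "\<And>i. i < n \<Longrightarrow> d \<le> e i"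
    unfolding d_def using e(1) by auto
  show thesis
  proof (rule that[OF d(1)], intro ballI impI)
    fix x assume x: "x \<in> topspace (Euclidean_space n)" and box: "\<forall>i<n. \<bar>x i - p i\<bar> < d"
    have "x i \<in> U i" for i
    proof (cases "i < n")
      case True
      then show ?thesis using box True d(2)[OF True] e(2)[of i]
        by (force simp: dist_real_def)
    next
      case False
      then have "x i = p i" using x p WT by (auto simp: topspace_Euclidean_space)
      then show ?thesis using U(2) by (auto simp: PiE_UNIV_domain)
    qed
    then show "x \<in> W" using U(3) x WT by (auto simp: PiE_UNIV_domain topspace_Euclidean_space)
  qed
qed

lemma limitin_Euclidean_space:
  assumes l: "l \<in> topspace (Euclidean_space n)"
    and x: "\<forall>\<^sub>F k in F. x k \<in> topspace (Euclidean_space n)"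
    and lim: "\<And>i. i < n \<Longrightarrow> ((\<lambda>k. x k i) \<longlongrightarrow> l i) F"
  shows "limitin (Euclidean_space n) x l F"
  unfolding limitin_def
proof (intro conjI allI impI l)
  fix W assume W: "openin (Euclidean_space n) W \<and> l \<in> W"
  obtain d where d: "d > 0"
    "\<forall>x\<in>topspace (Euclidean_space n). (\<forall>i<n. \<bar>x i - l i\<bar> < d) \<longrightarrow> x \<in> W"
    by (rule openin_Euclidean_space_box[OF conjunct1[OF W] conjunct2[OF W]]) (rule that)
  have "\<forall>\<^sub>F k in F. \<forall>i\<in>{..<n}. \<bar>x k i - l i\<bar> < d"
    by (intro eventually_ball_finite ballI finite_lessThan) (use tendstoD[OF lim d(1)] in \<open>auto simp: dist_real_def\<close>)
  with x show "\<forall>\<^sub>F k in F. x k \<in> W"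
    by eventually_elim (use d(2) in simp)
qed

lemma eventually_fun_upd_in:
  assumes "openin (Euclidean_space n) W" "x \<in> W" "i < n"
  shows "\<forall>\<^sub>F t in nhds (x i). x(i := t) \<in> W"
proof -
  obtain d where d: "d > 0"
    "\<forall>y\<in>topspace (Euclidean_space n). (\<forall>i<n. \<bar>y i - x i\<bar> < d) \<longrightarrow> y \<in> W"
    by (rule openin_Euclidean_space_box[OF assms(1,2)]) (rule that)
  have "x \<in> topspace (Euclidean_space n)"
    using assms openin_subset by blast
  then show ?thesis
    unfolding eventually_nhds_metric using d(1) assms(3)
    by (intro exI[of _ d]) (auto intro!: d(2)[rule_format] fun_upd_in_Euclidean_space simp: dist_real_def)
qed

subsection \<open>Locality\<close>

lemma Ck_on_mono: "\<lbrakk>Ck_on n k W f; W' \<subseteq> W\<rbrakk> \<Longrightarrow> Ck_on n k W' f"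
proof (induction k arbitrary: f)
  case 0
  then show ?case using continuous_map_from_subtopology_mono by auto
next
  case (Suc k)
  then show ?case using continuous_map_from_subtopology_mono by (auto; blast)
qed

lemma Ck_on_SucD: "Ck_on n (Suc k) W f \<Longrightarrow> Ck_on n k W f"
  by (induction k arbitrary: f) auto

lemma Ck_on_continuous: "Ck_on n k W f \<Longrightarrow> continuous_map (subtopology (Euclidean_space n) W) euclideanreal f"
  by (cases k) auto

lemma partial_deriv_cong:
  assumes "openin (Euclidean_space n) W" "\<And>x. x \<in> W \<Longrightarrow> f x = g x" "x \<in> W" "i < n"
  shows "partial_deriv i f x = partial_deriv i g x"
proof -
  have "\<forall>\<^sub>F t in nhds (x i). f (x(i := t)) = g (x(i := t))"
    using eventually_fun_upd_in[OF assms(1,3,4)] by eventually_elim (rule assms(2))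
  then show ?thesis
    unfolding partial_deriv_def by (intro deriv_cong_ev) auto
qed

lemma real_differentiable_cong_ev:
  fixes f g :: "real \<Rightarrow> real"
  assumes "\<forall>\<^sub>F t in nhds a. f t = g t" "f differentiable (at a)"
  shows "g differentiable (at a)"
  using assms DERIV_cong_ev[OF refl assms(1) refl] by (auto simp: real_differentiable_def)

lemma Ck_on_cong:
  assumes "openin (Euclidean_space n) W" "\<And>x. x \<in> W \<Longrightarrow> f x = g x" "Ck_on n k W f"
  shows "Ck_on n k W g"
  using assms(2,3)
proof (induction k arbitrary: f g)
  case 0
  then show ?case by (auto intro: continuous_map_eq)
next
  case (Suc k)
  have "continuous_map (subtopology (Euclidean_space n) W) euclideanreal g"
    using Suc.prems by (auto intro: continuous_map_eq)
  moreover have "(\<lambda>t. g (x(i := t))) differentiable (at (x i))" if "i < n" "x \<in> W" for i x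
  proof (rule real_differentiable_cong_ev)
    show "\<forall>\<^sub>F t in nhds (x i). f (x(i := t)) = g (x(i := t))"
      using eventually_fun_upd_in[OF assms(1) that(2,1)] by eventually_elim (rule Suc.prems(1))
    show "(\<lambda>t. f (x(i := t))) differentiable (at (x i))" using Suc.prems(2) that by auto
  qed
  moreover have "Ck_on n k W (partial_deriv i g)" if "i < n" for i
    using Suc.IH[of "partial_deriv i f" "partial_deriv i g"] Suc.prems that
      partial_deriv_cong[OF assms(1), of f g] by auto
  ultimately show ?case by auto
qed

lemma Ck_on_local:
  assumes "\<And>x. x \<in> W \<Longrightarrow> \<exists>W'. openin (Euclidean_space n) W' \<and> x \<in> W' \<and> W' \<subseteq> W \<and> Ck_on n k W' f"
  shows "Ck_on n k W f"
  using assms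
proof (induction k arbitrary: f)
  case 0
  then obtain T where T: "\<And>x. x \<in> W \<Longrightarrow> openin (Euclidean_space n) (T x) \<and> x \<in> T x \<and> T x \<subseteq> W \<and> Ck_on n 0 (T x) f"
    by metis
  have "continuous_map (subtopology (Euclidean_space n) W) euclideanreal f"
  proof (rule pasting_lemma[where I = W and T = T and f = "\<lambda>_. f"])
    fix x assume "x \<in> W"
    then show "openin (subtopology (Euclidean_space n) W) (T x)"
      using T by (metis inf.absorb_iff1 openin_subtopology)
    show "continuous_map (subtopology (subtopology (Euclidean_space n) W) (T x)) euclideanreal f"
      using T[OF \<open>x \<in> W\<close>] by (simp add: subtopology_subtopology inf.absorb2)
  qed (use T in auto)
  then show ?case by simp
next
  case (Suc k)
  have "Ck_on n k W f" by (rule Suc.IH) (meson Suc.prems Ck_on_SucD)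
  moreover have "Ck_on n k W (partial_deriv i f)" if "i < n" for i
    by (rule Suc.IH) (use Suc.prems that in force)
  moreover have "(\<lambda>t. f (x(i := t))) differentiable (at (x i))" if "i < n" "x \<in> W" for i x
    using Suc.prems[OF that(2)] that by auto
  ultimately show ?case using Ck_on_continuous by auto
qed

lemma smooth_on_mono: "\<lbrakk>smooth_on n W f; W' \<subseteq> W\<rbrakk> \<Longrightarrow> smooth_on n W' f"
  unfolding smooth_on_def using Ck_on_mono by blast

lemma smooth_on_cong:
  "\<lbrakk>openin (Euclidean_space n) W; \<And>x. x \<in> W \<Longrightarrow> f x = g x; smooth_on n W f\<rbrakk> \<Longrightarrow> smooth_on n W g"
  unfolding smooth_on_def by (blast intro: Ck_on_cong)

lemma smooth_on_local:
  assumes "\<And>x. x \<in> W \<Longrightarrow> \<exists>W'. openin (Euclidean_space n) W' \<and> x \<in> W' \<and> W' \<subseteq> W \<and> smooth_on n W' f"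
  shows "smooth_on n W f"
  unfolding smooth_on_def
proof
  show "Ck_on n k W f" for k
    by (rule Ck_on_local) (use assms[unfolded smooth_on_def] in blast)
qed

lemma has_real_derivative_partial_deriv:
  assumes "Ck_on n (Suc k) W f" "x \<in> W" "i < n"
  shows "((\<lambda>t. f (x(i := t))) has_real_derivative partial_deriv i f x) (at (x i))"
  using assms by (auto simp: partial_deriv_def DERIV_deriv_iff_real_differentiable)

subsection \<open>Strict differentiability and the chain rule along curves\<close>

text \<open>
  A \<open>C\<^sup>1\<close> function is strictly differentiable: passing from \<open>y\<close> to \<open>x\<close> one coordinate at
  a time, the mean value theorem compares each increment with the derivative at the centre \<open>p\<close>.
  That both points may vary is what later controls products \<open>a b\<close> and \<open>a' b'\<close> of group
  elements near the identity.
\<close>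

lemma C1_strict_derivative:
  assumes W: "openin (Euclidean_space n) W" and f: "Ck_on n (Suc 0) W f" and p: "p \<in> W" and e: "e > 0"
  obtains d where "d > 0"
    "\<forall>x\<in>topspace (Euclidean_space n). (\<forall>i<n. \<bar>x i - p i\<bar> < d) \<longrightarrow> x \<in> W"
    "\<forall>x\<in>topspace (Euclidean_space n). \<forall>y\<in>topspace (Euclidean_space n).
       (\<forall>i<n. \<bar>x i - p i\<bar> < d) \<longrightarrow> (\<forall>i<n. \<bar>y i - p i\<bar> < d) \<longrightarrow>
       \<bar>f x - f y - (\<Sum>i<n. partial_deriv i f p * (x i - y i))\<bar> \<le> e * (\<Sum>i<n. \<bar>x i - y i\<bar>)"
proof -
  let ?E = "Euclidean_space n"
  define T where "T i = {x \<in> W. partial_deriv i f x \<in> ball (partial_deriv i f p) e}" for i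
  have "openin ?E (T i)" if "i < n" for i
  proof -
    have "openin (subtopology ?E W) {x \<in> topspace (subtopology ?E W). partial_deriv i f x \<in> ball (partial_deriv i f p) e}"
      by (rule openin_continuous_map_preimage[where Y = euclideanreal]) (use f that in auto)
    then have "openin ?E {x \<in> topspace (subtopology ?E W). partial_deriv i f x \<in> ball (partial_deriv i f p) e}"
      using W by (rule openin_trans_full)
    moreover have "topspace (subtopology ?E W) = W" using W openin_subset by fastforce
    ultimately show ?thesis unfolding T_def by (simp only:)
  qed
  then have "openin ?E (W \<inter> (\<Inter>i\<in>{..<n}. T i))"
    using W by (cases "n = 0") (auto intro!: openin_Int openin_Inter)
  moreover have "p \<in> W \<inter> (\<Inter>i\<in>{..<n}. T i)" using p e by (auto simp: T_def)
  ultimately obtain d where d: "d > 0" and box: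
    "\<forall>x\<in>topspace ?E. (\<forall>i<n. \<bar>x i - p i\<bar> < d) \<longrightarrow> x \<in> W \<inter> (\<Inter>i\<in>{..<n}. T i)"
    by (rule openin_Euclidean_space_box) (rule that)
  show thesis
  proof (rule that[OF d])
    show "\<forall>x\<in>topspace ?E. (\<forall>i<n. \<bar>x i - p i\<bar> < d) \<longrightarrow> x \<in> W"
      using box by blast
  next
    show "\<forall>x\<in>topspace ?E. \<forall>y\<in>topspace ?E. (\<forall>i<n. \<bar>x i - p i\<bar> < d) \<longrightarrow> (\<forall>i<n. \<bar>y i - p i\<bar> < d) \<longrightarrow>
       \<bar>f x - f y - (\<Sum>i<n. partial_deriv i f p * (x i - y i))\<bar> \<le> e * (\<Sum>i<n. \<bar>x i - y i\<bar>)"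
    proof (intro ballI impI)
    fix x y assume xy: "x \<in> topspace ?E" "y \<in> topspace ?E"
      and "\<forall>i<n. \<bar>x i - p i\<bar> < d" "\<forall>i<n. \<bar>y i - p i\<bar> < d"
    then have x: "\<And>i. i < n \<Longrightarrow> \<bar>x i - p i\<bar> < d" and y: "\<And>i. i < n \<Longrightarrow> \<bar>y i - p i\<bar> < d" by auto
    define z where "z k = (\<lambda>i. if i < k then x i else y i)" for k
    have z0: "z 0 = y" and zn: "z n = x"
      using xy by (auto simp: z_def topspace_Euclidean_space fun_eq_iff)
    have step: "\<bar>(f (z (Suc k)) - f (z k)) - partial_deriv k f p * (x k - y k)\<bar> \<le> e * \<bar>x k - y k\<bar>"
      if k: "k < n" for k
    proof -
      define g where "g t = f ((z k)(k := t))" for t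
      let ?S = "closed_segment (y k) (x k)"
      have in_box: "(z k)(k := t) \<in> W \<inter> (\<Inter>i\<in>{..<n}. T i)" if "t \<in> ?S" for t
      proof (rule box[rule_format])
        show "(z k)(k := t) \<in> topspace ?E"
          using xy k by (auto simp: z_def topspace_Euclidean_space)
        have "\<bar>t - p k\<bar> < d" using x[OF k] y[OF k] that
          by (auto simp: closed_segment_eq_real_ivl split: if_splits)
        then show "\<bar>((z k)(k := t)) i - p i\<bar> < d" if "i < n" for i
          using x[OF that] y[OF that] by (auto simp: z_def)
      qed
      have deriv: "(g has_real_derivative partial_deriv k f ((z k)(k := t))) (at t)" if "t \<in> ?S" for t
        using has_real_derivative_partial_deriv[OF f _ k, of "(z k)(k := t)"] in_box[OF that]
        by (simp add: g_def[abs_def])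
      have "norm ((g (x k) - partial_deriv k f p * x k) - (g (y k) - partial_deriv k f p * y k))
          \<le> e * norm (x k - y k)"
      proof (rule field_differentiable_bound[of ?S])
        fix t assume t: "t \<in> ?S"
        show "((\<lambda>t. g t - partial_deriv k f p * t) has_field_derivative
            (partial_deriv k f ((z k)(k := t)) - partial_deriv k f p)) (at t within ?S)"
          by (rule has_field_derivative_at_within) (auto intro!: derivative_eq_intros deriv[OF t])
        show "norm (partial_deriv k f ((z k)(k := t)) - partial_deriv k f p) \<le> e"
        proof -
          have "(z k)(k := t) \<in> T k" using in_box[OF t] k by blast
          then have "partial_deriv k f ((z k)(k := t)) \<in> ball (partial_deriv k f p) e"
            unfolding T_def by blast
          then show ?thesis by (simp add: dist_norm norm_minus_commute)
        qed
      qed auto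
      moreover have "g (x k) = f (z (Suc k))"
        unfolding g_def by (rule arg_cong[where f = f]) (auto simp: z_def fun_eq_iff less_Suc_eq)
      moreover have "g (y k) = f (z k)"
        unfolding g_def by (rule arg_cong[where f = f]) (auto simp: z_def fun_eq_iff)
      ultimately show ?thesis by (simp add: algebra_simps)
    qed
    have "f x - f y = (\<Sum>k<n. f (z (Suc k)) - f (z k))"
      using sum_lessThan_telescope[of "\<lambda>k. f (z k)" n] by (simp only: z0 zn)
    then have "\<bar>f x - f y - (\<Sum>i<n. partial_deriv i f p * (x i - y i))\<bar>
        = \<bar>\<Sum>k<n. (f (z (Suc k)) - f (z k)) - partial_deriv k f p * (x k - y k)\<bar>"
      by (simp add: sum_subtractf)
    also have "\<dots> \<le> (\<Sum>k<n. e * \<bar>x k - y k\<bar>)"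
      by (rule order_trans[OF sum_abs]) (use step in \<open>auto intro!: sum_mono\<close>)
    finally show "\<bar>f x - f y - (\<Sum>i<n. partial_deriv i f p * (x i - y i))\<bar> \<le> e * (\<Sum>i<n. \<bar>x i - y i\<bar>)"
      by (simp add: sum_distrib_left)
    qed
  qed
qed

text \<open>
  This is strict differentiability with one of the two points fixed at the centre. Taking for \<open>c\<close> a coordinate line composed with a map gives the
  partial derivatives of a composite.
\<close>

lemma C1_chain_rule:
  assumes W: "openin (Euclidean_space n) W" and f: "Ck_on n (Suc 0) W f" and p: "c a \<in> W"
    and c: "\<forall>\<^sub>F t in nhds a. c t \<in> topspace (Euclidean_space n)"
    and c': "\<And>i. i < n \<Longrightarrow> ((\<lambda>t. c t i) has_real_derivative c' i) (at a)"
  shows "((\<lambda>t. f (c t)) has_real_derivative (\<Sum>i<n. partial_deriv i f (c a) * c' i)) (at a)"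
proof -
  let ?D = "\<lambda>i. partial_deriv i f (c a)"
  have quot: "((\<lambda>t. (c t i - c a i) / (t - a)) \<longlongrightarrow> c' i) (at a)" if "i < n" for i
    using c'[OF that] by (simp add: has_field_derivative_iff)
  have lin: "((\<lambda>t. \<Sum>i<n. ?D i * ((c t i - c a i) / (t - a))) \<longlongrightarrow> (\<Sum>i<n. ?D i * c' i)) (at a)"
    by (intro tendsto_intros) (use quot in auto)
  define r where "r t = f (c t) - f (c a) - (\<Sum>i<n. ?D i * (c t i - c a i))" for t
  have "((\<lambda>t. r t / (t - a)) \<longlongrightarrow> 0) (at a)"
  proof (rule tendstoI)
    fix e :: real assume e: "e > 0"
    define K where "K = (\<Sum>i<n. \<bar>c' i\<bar>) + 1"
    have K: "K > 0" unfolding K_def by (simp add: add_nonneg_pos sum_nonneg)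
    have e2: "e / (2 * K) > 0" using e K by simp
    obtain d where d: "d > 0" and strict:
      "\<forall>x\<in>topspace (Euclidean_space n). \<forall>y\<in>topspace (Euclidean_space n).
       (\<forall>i<n. \<bar>x i - c a i\<bar> < d) \<longrightarrow> (\<forall>i<n. \<bar>y i - c a i\<bar> < d) \<longrightarrow>
       \<bar>f x - f y - (\<Sum>i<n. ?D i * (x i - y i))\<bar> \<le> e / (2 * K) * (\<Sum>i<n. \<bar>x i - y i\<bar>)"
      by (rule C1_strict_derivative[OF W f p e2]) (rule that)
    have ctop: "c a \<in> topspace (Euclidean_space n)" using W p openin_subset by blast
    have "((\<lambda>t. c t i) \<longlongrightarrow> c a i) (at a)" if "i < n" for i
      using DERIV_isCont[OF c'[OF that]] by (simp add: isCont_def)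
    then have "\<forall>\<^sub>F t in at a. \<forall>i\<in>{..<n}. \<bar>c t i - c a i\<bar> < d"
      by (intro eventually_ball_finite ballI finite_lessThan) (use d in \<open>auto simp: tendsto_iff dist_real_def\<close>)
    moreover have "((\<lambda>t. \<Sum>i<n. \<bar>(c t i - c a i) / (t - a)\<bar>) \<longlongrightarrow> (\<Sum>i<n. \<bar>c' i\<bar>)) (at a)"
      by (intro tendsto_intros) (use quot in auto)
    then have "\<forall>\<^sub>F t in at a. (\<Sum>i<n. \<bar>(c t i - c a i) / (t - a)\<bar>) < K"
      by (rule order_tendstoD) (simp add: K_def)
    moreover have "\<forall>\<^sub>F t in at a. c t \<in> topspace (Euclidean_space n)"
      using c eventually_nhds_conv_at by blast
    moreover have "\<forall>\<^sub>F t in at a. t \<noteq> a" by (simp add: eventually_at_filter)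
    ultimately show "\<forall>\<^sub>F t in at a. dist (r t / (t - a)) 0 < e"
    proof eventually_elim
      case (elim t)
      have "\<bar>r t\<bar> \<le> e / (2 * K) * (\<Sum>i<n. \<bar>c t i - c a i\<bar>)"
        unfolding r_def by (rule strict[rule_format]) (use elim ctop d in auto)
      then have "\<bar>r t\<bar> / \<bar>t - a\<bar> \<le> e / (2 * K) * (\<Sum>i<n. \<bar>c t i - c a i\<bar>) / \<bar>t - a\<bar>"
        by (rule divide_right_mono) simp
      also have "\<dots> = e / (2 * K) * (\<Sum>i<n. \<bar>(c t i - c a i) / (t - a)\<bar>)"
        by (simp add: sum_divide_distrib[symmetric] abs_divide)
      also have "\<dots> \<le> e / (2 * K) * K"
        using elim e2 by (intro mult_left_mono) auto
      also have "\<dots> < e" using e K by simp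
      finally show ?case by (simp add: abs_divide dist_real_def)
    qed
  qed
  from tendsto_add[OF this lin]
  have "((\<lambda>t. r t / (t - a) + (\<Sum>i<n. ?D i * ((c t i - c a i) / (t - a)))) \<longlongrightarrow> (\<Sum>i<n. ?D i * c' i)) (at a)"
    by simp
  moreover have "r t / (t - a) + (\<Sum>i<n. ?D i * ((c t i - c a i) / (t - a))) = (f (c t) - f (c a)) / (t - a)" for t
  proof -
    have "(\<Sum>i<n. ?D i * ((c t i - c a i) / (t - a))) = (\<Sum>i<n. ?D i * (c t i - c a i)) / (t - a)"
      by (simp only: sum_divide_distrib times_divide_eq_right)
    then show ?thesis by (simp add: r_def flip: add_divide_distrib)
  qed
  ultimately show ?thesis by (simp add: has_field_derivative_iff)
qed

subsection \<open>Sums, products and composites\<close>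

lemma Ck_on_const: "Ck_on n k W (\<lambda>_. c)"
proof (induction k arbitrary: c)
  case (Suc k)
  have "partial_deriv i (\<lambda>_. c) = (\<lambda>_. 0)" for i by (auto simp: partial_deriv_def)
  with Suc show ?case by auto
qed auto

lemma Ck_on_coordinate: "Ck_on n k W (\<lambda>x. x j)"
proof (cases k)
  case 0
  then show ?thesis by (simp add: continuous_map_from_subtopology continuous_map_Euclidean_space_coordinate)
next
  case (Suc k')
  have "partial_deriv i (\<lambda>x. x j) = (\<lambda>x. if i = j then 1 else 0)" for i
    by (auto simp: partial_deriv_def fun_eq_iff)
  moreover have "(\<lambda>t. (x(i := t)) j) differentiable (at (x i))" for x :: "nat \<Rightarrow> real" and i
    by (cases "i = j") auto
  moreover have "Ck_on n k' W (\<lambda>x. if i = j then 1 else 0)" for i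
    by (rule Ck_on_const)
  ultimately show ?thesis
    using Suc by (simp del: fun_upd_apply add: continuous_map_from_subtopology continuous_map_Euclidean_space_coordinate)
qed

text \<open>
  Any formula that computes the partial derivatives on the open set \<open>W\<close> may serve for the induction on
  \<open>k\<close>; off \<open>W\<close> it can differ from \<^const>\<open>partial_deriv\<close>.
\<close>

lemma Ck_on_SucI:
  assumes "openin (Euclidean_space n) W"
    and "continuous_map (subtopology (Euclidean_space n) W) euclideanreal f"
    and f': "\<And>i x. \<lbrakk>i < n; x \<in> W\<rbrakk> \<Longrightarrow> ((\<lambda>t. f (x(i := t))) has_real_derivative f' i x) (at (x i))"
    and "\<And>i. i < n \<Longrightarrow> Ck_on n k W (f' i)"
  shows "Ck_on n (Suc k) W f"
proof -
  have "Ck_on n k W (partial_deriv i f)" if "i < n" for i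
    using assms that by (intro Ck_on_cong[OF assms(1) _ assms(4)[OF that]])
      (simp add: partial_deriv_def DERIV_imp_deriv[OF f'])
  then show ?thesis using assms(2) f' by (auto simp: real_differentiable_def)
qed

lemma Ck_on_add:
  assumes "openin (Euclidean_space n) W" "Ck_on n k W f" "Ck_on n k W g"
  shows "Ck_on n k W (\<lambda>x. f x + g x)"
  using assms(2,3)
proof (induction k arbitrary: f g)
  case 0
  then show ?case by (auto intro: continuous_map_add)
next
  case (Suc k)
  show ?case
  proof (rule Ck_on_SucI[OF assms(1)])
    show "((\<lambda>t. f (x(i := t)) + g (x(i := t))) has_real_derivative partial_deriv i f x + partial_deriv i g x) (at (x i))"
      if "i < n" "x \<in> W" for i x
      using that by (intro DERIV_add has_real_derivative_partial_deriv[OF Suc.prems(1)]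
          has_real_derivative_partial_deriv[OF Suc.prems(2)])
  qed (use Suc in \<open>auto intro: continuous_map_add\<close>)
qed

lemma Ck_on_mult:
  assumes "openin (Euclidean_space n) W" "Ck_on n k W f" "Ck_on n k W g"
  shows "Ck_on n k W (\<lambda>x. f x * g x)"
  using assms(2,3)
proof (induction k arbitrary: f g)
  case 0
  then show ?case by (auto intro: continuous_map_real_mult)
next
  case (Suc k)
  show ?case
  proof (rule Ck_on_SucI[OF assms(1)])
    show "((\<lambda>t. f (x(i := t)) * g (x(i := t))) has_real_derivative partial_deriv i f x * g x + partial_deriv i g x * f x) (at (x i))"
      if "i < n" "x \<in> W" for i x
      using DERIV_mult[OF has_real_derivative_partial_deriv[OF Suc.prems(1) that(2,1)]
          has_real_derivative_partial_deriv[OF Suc.prems(2) that(2,1)]] by (simp del: fun_upd_apply)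
    show "Ck_on n k W (\<lambda>x. partial_deriv i f x * g x + partial_deriv i g x * f x)" if "i < n" for i
      using Suc.prems that Suc.prems[THEN Ck_on_SucD] by (intro Ck_on_add[OF assms(1)] Suc.IH) auto
  qed (use Suc in \<open>auto intro: continuous_map_real_mult\<close>)
qed

lemma Ck_on_sum:
  assumes "openin (Euclidean_space n) W" "\<And>i. i \<in> I \<Longrightarrow> Ck_on n k W (f i)" "finite I"
  shows "Ck_on n k W (\<lambda>x. \<Sum>i\<in>I. f i x)"
  using assms(3,2)
  by (induction I) (auto intro: Ck_on_add[OF assms(1)] Ck_on_const)

lemma continuous_map_into_Euclidean_space:
  assumes "\<And>i. i < n \<Longrightarrow> continuous_map X euclideanreal (\<lambda>x. \<Phi> x i)"
    and "\<And>x. x \<in> topspace X \<Longrightarrow> \<Phi> x \<in> topspace (Euclidean_space n)"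
  shows "continuous_map X (Euclidean_space n) \<Phi>"
proof (rule continuous_map_eq)
  show "continuous_map X (Euclidean_space n) (\<lambda>x i. if i < n then \<Phi> x i else 0)"
    using assms(1) by (simp add: continuous_map_componentwise_Euclidean_space)
qed (use assms(2) in \<open>auto simp: topspace_Euclidean_space\<close>)

lemma Ck_on_compose:
  assumes W: "openin (Euclidean_space m) W" and V: "openin (Euclidean_space n) V"
    and \<Phi>V: "\<Phi> ` W \<subseteq> V" and \<Phi>: "\<And>j. j < n \<Longrightarrow> Ck_on m k W (\<lambda>x. \<Phi> x j)" and f: "Ck_on n k V f"
  shows "Ck_on m k W (\<lambda>x. f (\<Phi> x))"
  using \<Phi> f
proof (induction k arbitrary: f)
  case 0
  have top: "topspace (subtopology (Euclidean_space m) W) = W" using W openin_subset by fastforce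
  have "continuous_map (subtopology (Euclidean_space m) W) (Euclidean_space n) \<Phi>"
    using 0 \<Phi>V V openin_subset by (intro continuous_map_into_Euclidean_space) (fastforce simp: top)+
  then have "continuous_map (subtopology (Euclidean_space m) W) (subtopology (Euclidean_space n) V) \<Phi>"
    using \<Phi>V by (auto simp: continuous_map_in_subtopology top)
  then show ?case using 0 continuous_map_compose[unfolded comp_def] by fastforce
next
  case (Suc k)
  have IH: "Ck_on m k W (\<lambda>x. g (\<Phi> x))" if "Ck_on n k V g" for g
    by (rule Suc.IH[OF Ck_on_SucD[OF Suc.prems(1)] that])
  show ?case
  proof (rule Ck_on_SucI[OF W])
    show "continuous_map (subtopology (Euclidean_space m) W) euclideanreal (\<lambda>x. f (\<Phi> x))"
      by (rule Ck_on_continuous[OF IH[OF Ck_on_SucD[OF Suc.prems(2)]]])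
    show "((\<lambda>t. f (\<Phi> (x(i := t)))) has_real_derivative
        (\<Sum>j<n. partial_deriv j f (\<Phi> x) * partial_deriv i (\<lambda>x. \<Phi> x j) x)) (at (x i))"
      if i: "i < m" and x: "x \<in> W" for i x
    proof -
      have "((\<lambda>t. f (\<Phi> (x(i := t)))) has_real_derivative
          (\<Sum>j<n. partial_deriv j f (\<Phi> (x(i := x i))) * partial_deriv i (\<lambda>x. \<Phi> x j) x)) (at (x i))"
      proof (rule C1_chain_rule[OF V])
        show "Ck_on n (Suc 0) V f"
          using Suc.prems(2) Ck_on_continuous by auto
        show "\<Phi> (x(i := x i)) \<in> V" using x \<Phi>V by auto
        show "\<forall>\<^sub>F t in nhds (x i). \<Phi> (x(i := t)) \<in> topspace (Euclidean_space n)"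
          using eventually_fun_upd_in[OF W x i] by eventually_elim (use \<Phi>V V openin_subset in fastforce)
        show "((\<lambda>t. \<Phi> (x(i := t)) j) has_real_derivative partial_deriv i (\<lambda>x. \<Phi> x j) x) (at (x i))"
          if "j < n" for j
          by (rule has_real_derivative_partial_deriv[OF Suc.prems(1)[OF that] x i])
      qed
      then show ?thesis by simp
    qed
    show "Ck_on m k W (\<lambda>x. \<Sum>j<n. partial_deriv j f (\<Phi> x) * partial_deriv i (\<lambda>x. \<Phi> x j) x)"
      if i: "i < m" for i
      by (intro Ck_on_sum[OF W] Ck_on_mult[OF W] IH) (use Suc.prems i in auto)
  qed
qed

lemma smooth_on_compose:
  assumes "openin (Euclidean_space m) W" "openin (Euclidean_space n) V"
    and "\<Phi> ` W \<subseteq> V" "\<And>j. j < n \<Longrightarrow> smooth_on m W (\<lambda>x. \<Phi> x j)" "smooth_on n V f"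
  shows "smooth_on m W (\<lambda>x. f (\<Phi> x))"
  using Ck_on_compose[OF assms(1-3)] assms(4,5) unfolding smooth_on_def by blast

section \<open>Smooth maps between manifolds\<close>

text \<open>
  The topological half of \<^locale>\<open>smooth_manifold\<close>: charts are homeomorphisms onto open sets and cover
  the space. This is what composing smooth maps takes, and it is inherited by products and holds for the
  real line by direct verification.
\<close>

locale charted_space =
  fixes M :: "'a manifold"
  assumes open_domain: "(U, \<phi>) \<in> charts M \<Longrightarrow> openin (mtop M) U"
    and open_range: "(U, \<phi>) \<in> charts M \<Longrightarrow> openin (Euclidean_space (mdim M)) (\<phi> ` U)"
    and homeomorphic: "(U, \<phi>) \<in> charts M \<Longrightarrow>
      homeomorphic_map (subtopology (mtop M) U) (subtopology (Euclidean_space (mdim M)) (\<phi> ` U)) \<phi>"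
    and covered: "p \<in> topspace (mtop M) \<Longrightarrow> \<exists>U \<phi>. (U, \<phi>) \<in> charts M \<and> p \<in> U"
begin

lemma domain_subset: "(U, \<phi>) \<in> charts M \<Longrightarrow> U \<subseteq> topspace (mtop M)"
  using open_domain openin_subset by blast

lemma topspace_domain: "(U, \<phi>) \<in> charts M \<Longrightarrow> topspace (subtopology (mtop M) U) = U"
  using domain_subset by fastforce

lemma chart_in_Euclidean_space:
  "\<lbrakk>(U, \<phi>) \<in> charts M; p \<in> U\<rbrakk> \<Longrightarrow> \<phi> p \<in> topspace (Euclidean_space (mdim M))"
  using open_range openin_subset by blast

lemma inv_chart: "\<lbrakk>(U, \<phi>) \<in> charts M; p \<in> U\<rbrakk> \<Longrightarrow> inv_into U \<phi> (\<phi> p) = p"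
  using homeomorphic topspace_domain homeomorphic_imp_injective_map inv_into_f_f by metis

lemma open_chart_image:
  assumes c: "(U, \<phi>) \<in> charts M" and S: "openin (mtop M) S" "S \<subseteq> U"
  shows "openin (Euclidean_space (mdim M)) (\<phi> ` S)"
proof -
  have "openin (subtopology (mtop M) U) S"
    using S by (metis inf.absorb_iff1 openin_subtopology)
  then have "openin (subtopology (Euclidean_space (mdim M)) (\<phi> ` U)) (\<phi> ` S)"
    using homeomorphic_imp_open_map[OF homeomorphic[OF c]] by (simp add: open_map_def)
  then show ?thesis using open_range[OF c] openin_trans_full by blast
qed

lemma continuous_chart:
  assumes c: "(U, \<phi>) \<in> charts M"
  shows "continuous_map (subtopology (mtop M) U) (Euclidean_space (mdim M)) \<phi>"
  using homeomorphic_imp_continuous_map[OF homeomorphic[OF c]] continuous_map_into_fulltopology by blast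

lemma continuous_inv_chart:
  assumes c: "(U, \<phi>) \<in> charts M"
  shows "continuous_map (subtopology (Euclidean_space (mdim M)) (\<phi> ` U)) (subtopology (mtop M) U) (inv_into U \<phi>)"
proof -
  obtain g where g: "homeomorphic_maps (subtopology (mtop M) U) (subtopology (Euclidean_space (mdim M)) (\<phi> ` U)) \<phi> g"
    using homeomorphic[OF c] homeomorphic_map_maps by blast
  then have "continuous_map (subtopology (Euclidean_space (mdim M)) (\<phi> ` U)) (subtopology (mtop M) U) g"
    by (simp add: homeomorphic_maps_def)
  then show ?thesis
  proof (rule continuous_map_eq)
    fix x assume "x \<in> topspace (subtopology (Euclidean_space (mdim M)) (\<phi> ` U))"
    then obtain p where p: "p \<in> U" "x = \<phi> p" by auto
    then have "g x = p" using g topspace_domain[OF c] by (simp add: homeomorphic_maps_def)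
    then show "g x = inv_into U \<phi> x" using inv_chart[OF c p(1)] p(2) by simp
  qed
qed

end

lemma (in smooth_manifold) charted_space: "charted_space M"
proof
  fix p assume "p \<in> topspace (mtop M)"
  then show "\<exists>U \<phi>. (U, \<phi>) \<in> charts M \<and> p \<in> U"
    unfolding charts_cover[symmetric] by auto
qed (fact chart_domain chart_range chart_homeomorphic)+

lemma smooth_map_continuous: "smooth_map M N F \<Longrightarrow> continuous_map (mtop M) (mtop N) F"
  by (simp add: smooth_map_def)

lemma smooth_map_in_charts:
  "\<lbrakk>smooth_map M N F; (U, \<phi>) \<in> charts M; (V, \<psi>) \<in> charts N; j < mdim N\<rbrakk> \<Longrightarrow>
    smooth_on (mdim M) (\<phi> ` {p \<in> U. F p \<in> V}) (\<lambda>x. \<psi> (F (inv_into U \<phi> x)) j)"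
  unfolding smooth_map_def by blast

lemma openin_preimage_in_domain:
  assumes "openin X U" "continuous_map X Y F" "openin Y V"
  shows "openin X {p \<in> U. F p \<in> V}"
proof -
  have "{p \<in> U. F p \<in> V} = U \<inter> {p \<in> topspace X. F p \<in> V}"
    using openin_subset[OF assms(1)] by blast
  then show ?thesis
    using openin_Int[OF assms(1) openin_continuous_map_preimage[OF assms(2,3)]] by simp
qed

text \<open>
  In charts a composite is the composite of the two local expressions, but only near each point,
  where the intermediate value stays in one chart of the middle manifold.
\<close>

lemma smooth_on_compose_in_charts:
  assumes M: "charted_space M" and N: "charted_space N" and F: "smooth_map M N F"
    and c: "(U, \<phi>) \<in> charts M" and Q: "openin (mtop N) Q"
    and g: "\<And>V \<psi>. (V, \<psi>) \<in> charts N \<Longrightarrow> smooth_on (mdim N) (\<psi> ` (V \<inter> Q)) (\<lambda>y. g (inv_into V \<psi> y))"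
  shows "smooth_on (mdim M) (\<phi> ` {p \<in> U. F p \<in> Q}) (\<lambda>x. g (F (inv_into U \<phi> x)))"
proof (rule smooth_on_local)
  interpret M: charted_space M by fact
  interpret N: charted_space N by fact
  note contF = smooth_map_continuous[OF F]
  fix x assume "x \<in> \<phi> ` {p \<in> U. F p \<in> Q}"
  then obtain p where p: "p \<in> U" "F p \<in> Q" "x = \<phi> p" by blast
  obtain V \<psi> where d: "(V, \<psi>) \<in> charts N" and V: "F p \<in> V"
    using N.covered p(2) openin_subset[OF Q] by blast
  define W where "W = \<phi> ` {q \<in> U. F q \<in> V \<inter> Q}"
  have W: "openin (Euclidean_space (mdim M)) W"
    unfolding W_def using openin_preimage_in_domain[OF M.open_domain[OF c] contF
      openin_Int[OF N.open_domain[OF d] Q]] by (intro M.open_chart_image[OF c]) auto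
  have "smooth_on (mdim M) W (\<lambda>x. g (inv_into V \<psi> (\<psi> (F (inv_into U \<phi> x)))))"
  proof (rule smooth_on_compose[OF W _ _ _ g[OF d]])
    show "openin (Euclidean_space (mdim N)) (\<psi> ` (V \<inter> Q))"
      using openin_Int[OF N.open_domain[OF d] Q] by (intro N.open_chart_image[OF d]) auto
    show "(\<lambda>x. \<psi> (F (inv_into U \<phi> x))) ` W \<subseteq> \<psi> ` (V \<inter> Q)"
      using M.inv_chart[OF c] by (auto simp: W_def)
    show "smooth_on (mdim M) W (\<lambda>x. \<psi> (F (inv_into U \<phi> x)) j)" if "j < mdim N" for j
      by (rule smooth_on_mono[OF smooth_map_in_charts[OF F c d that]]) (auto simp: W_def)
  qed
  then have "smooth_on (mdim M) W (\<lambda>x. g (F (inv_into U \<phi> x)))"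
    by (rule smooth_on_cong[OF W, rotated])
      (use M.inv_chart[OF c] N.inv_chart[OF d] in \<open>auto simp: W_def\<close>)
  moreover have "x \<in> W" "W \<subseteq> \<phi> ` {p \<in> U. F p \<in> Q}" using p V by (auto simp: W_def)
  ultimately show "\<exists>W'. openin (Euclidean_space (mdim M)) W' \<and> x \<in> W' \<and> W' \<subseteq> \<phi> ` {p \<in> U. F p \<in> Q} \<and>
      smooth_on (mdim M) W' (\<lambda>x. g (F (inv_into U \<phi> x)))"
    using W by blast
qed

lemma smooth_map_compose:
  assumes M: "charted_space M" and N: "charted_space N" and P: "charted_space P"
    and F: "smooth_map M N F" and G: "smooth_map N P G"
  shows "smooth_map M P (\<lambda>p. G (F p))"
proof -
  interpret N: charted_space N by fact
  interpret P: charted_space P by fact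
  have "smooth_on (mdim M) (\<phi> ` {p \<in> U. G (F p) \<in> V}) (\<lambda>x. \<psi> (G (F (inv_into U \<phi> x))) j)"
    if c: "(U, \<phi>) \<in> charts M" and d: "(V, \<psi>) \<in> charts P" and j: "j < mdim P" for U \<phi> V \<psi> j
  proof -
    let ?Q = "{q \<in> topspace (mtop N). G q \<in> V}"
    have "smooth_on (mdim M) (\<phi> ` {p \<in> U. F p \<in> ?Q}) (\<lambda>x. \<psi> (G (F (inv_into U \<phi> x))) j)"
    proof (rule smooth_on_compose_in_charts[OF M N F c, where g = "\<lambda>q. \<psi> (G q) j"])
      show "openin (mtop N) ?Q"
        using openin_continuous_map_preimage[OF smooth_map_continuous[OF G] P.open_domain[OF d]] .
      fix Z \<zeta> assume z: "(Z, \<zeta>) \<in> charts N"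
      show "smooth_on (mdim N) (\<zeta> ` (Z \<inter> ?Q)) (\<lambda>y. \<psi> (G (inv_into Z \<zeta> y)) j)"
        by (rule smooth_on_mono[OF smooth_map_in_charts[OF G z d j]]) auto
    qed
    moreover have "F p \<in> topspace (mtop N)" if "p \<in> U" for p
      using that charted_space.domain_subset[OF M c] smooth_map_continuous[OF F]
      by (auto simp: continuous_map_def)
    then have "{p \<in> U. F p \<in> ?Q} = {p \<in> U. G (F p) \<in> V}" by auto
    ultimately show ?thesis by simp
  qed
  moreover have "continuous_map (mtop M) (mtop P) (\<lambda>p. G (F p))"
    using continuous_map_compose[OF smooth_map_continuous[OF F] smooth_map_continuous[OF G]]
    by (simp add: comp_def)
  ultimately show ?thesis unfolding smooth_map_def by blast
qed

text \<open>
  Pulling back keeps a function in the domain of tangent vectors, outside of which they are 0 by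
  convention. So a differential acts on a velocity by composing the curve with the map.
\<close>

lemma smooth_near_compose:
  assumes M: "charted_space M" and N: "charted_space N" and F: "smooth_map M N F"
    and p: "p \<in> topspace (mtop M)" and f: "smooth_near N (F p) f"
  shows "smooth_near M p (\<lambda>q. f (F q))"
proof -
  obtain Q where Q: "F p \<in> Q" "openin (mtop N) Q"
    and g: "\<And>V \<psi>. (V, \<psi>) \<in> charts N \<Longrightarrow> smooth_on (mdim N) (\<psi> ` (V \<inter> Q)) (\<lambda>y. f (inv_into V \<psi> y))"
    using f unfolding smooth_near_def by blast
  let ?W = "{q \<in> topspace (mtop M). F q \<in> Q}"
  have "smooth_on (mdim M) (\<phi> ` (U \<inter> ?W)) (\<lambda>x. f (F (inv_into U \<phi> x)))"
    if c: "(U, \<phi>) \<in> charts M" for U \<phi>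
    by (rule smooth_on_mono[OF smooth_on_compose_in_charts[OF M N F c Q(2) g]]) auto
  moreover have "openin (mtop M) ?W"
    using openin_continuous_map_preimage[OF smooth_map_continuous[OF F] Q(2)] .
  ultimately show ?thesis
    unfolding smooth_near_def using p Q(1) by (intro exI[of _ ?W]) auto
qed

lemma smooth_on_const: "smooth_on n W (\<lambda>_. c)"
  unfolding smooth_on_def by (auto intro: Ck_on_const)

lemma smooth_map_const: "c \<in> topspace (mtop N) \<Longrightarrow> smooth_map M N (\<lambda>_. c)"
  unfolding smooth_map_def by (auto intro: smooth_on_const)

lemma (in smooth_manifold) smooth_map_id: "smooth_map M M (\<lambda>x. x)"
  unfolding smooth_map_def using charts_compatible by (auto simp: Int_def)

subsection \<open>Products\<close>

lemma smooth_map_pair: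
  assumes "smooth_map K M \<alpha>" "smooth_map K N \<beta>"
  shows "smooth_map K (prod_manifold M N) (\<lambda>x. (\<alpha> x, \<beta> x))"
proof -
  have "smooth_on (mdim K) (\<phi> ` {p \<in> U. (\<alpha> p, \<beta> p) \<in> V \<times> V'})
      (\<lambda>x. if j < mdim M then \<psi> (\<alpha> (inv_into U \<phi> x)) j else \<psi>' (\<beta> (inv_into U \<phi> x)) (j - mdim M))"
    if "(U, \<phi>) \<in> charts K" "(V, \<psi>) \<in> charts M" "(V', \<psi>') \<in> charts N" "j < mdim M + mdim N" for U \<phi> V \<psi> V' \<psi>' j
  proof (cases "j < mdim M")
    case True
    have "smooth_on (mdim K) (\<phi> ` {p \<in> U. (\<alpha> p, \<beta> p) \<in> V \<times> V'}) (\<lambda>x. \<psi> (\<alpha> (inv_into U \<phi> x)) j)"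
      by (rule smooth_on_mono[OF smooth_map_in_charts[OF assms(1) that(1,2) True]]) auto
    then show ?thesis using True by simp
  next
    case False
    have "smooth_on (mdim K) (\<phi> ` {p \<in> U. (\<alpha> p, \<beta> p) \<in> V \<times> V'}) (\<lambda>x. \<psi>' (\<beta> (inv_into U \<phi> x)) (j - mdim M))"
      by (rule smooth_on_mono[OF smooth_map_in_charts[OF assms(2) that(1,3)]]) (use False that(4) in auto)
    then show ?thesis using False by simp
  qed
  moreover have "continuous_map (mtop K) (prod_topology (mtop M) (mtop N)) (\<lambda>x. (\<alpha> x, \<beta> x))"
    using assms[THEN smooth_map_continuous] by (simp add: continuous_map_pairwise comp_def)
  ultimately show ?thesis
    unfolding smooth_map_def prod_manifold_def by auto
qed

text \<open>
  The chart of a product concatenates coordinates. The two blocks of coordinates are recovered by the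
  continuous maps \<open>\<pi>1\<close> and \<open>\<pi>2\<close>, which give both the openness of the image and the inverse.
\<close>

lemma charted_space_prod:
  assumes "charted_space M" "charted_space N"
  shows "charted_space (prod_manifold M N)"
proof -
  interpret M: charted_space M by fact
  interpret N: charted_space N by fact
  define m n where "m = mdim M" and "n = mdim N"
  let ?E = "Euclidean_space (m + n)"
  define \<pi>1 where "\<pi>1 x = (\<lambda>i. if i < m then x i else 0)" for x :: "nat \<Rightarrow> real"
  define \<pi>2 where "\<pi>2 x = (\<lambda>i. if i < n then x (m + i) else 0)" for x :: "nat \<Rightarrow> real"
  have \<pi>1: "continuous_map ?E (Euclidean_space m) \<pi>1"
    unfolding \<pi>1_def continuous_map_componentwise_Euclidean_space
    by (simp add: continuous_map_Euclidean_space_coordinate)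
  have \<pi>2: "continuous_map ?E (Euclidean_space n) \<pi>2"
    unfolding \<pi>2_def continuous_map_componentwise_Euclidean_space
    by (simp add: continuous_map_Euclidean_space_coordinate)
  have charts: "openin (prod_topology (mtop M) (mtop N)) (U \<times> V) \<and> openin ?E (\<Phi> ` (U \<times> V)) \<and>
      homeomorphic_map (subtopology (prod_topology (mtop M) (mtop N)) (U \<times> V)) (subtopology ?E (\<Phi> ` (U \<times> V))) \<Phi>"
    if c: "(U, \<phi>) \<in> charts M" and d: "(V, \<psi>) \<in> charts N"
      and \<Phi>: "\<Phi> = (\<lambda>(p, q) i. if i < m then \<phi> p i else \<psi> q (i - m))" for U \<phi> V \<psi> \<Phi>
  proof -
    have top: "topspace (subtopology (prod_topology (mtop M) (mtop N)) (U \<times> V)) = U \<times> V"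
      using M.domain_subset[OF c] N.domain_subset[OF d] by auto
    have \<phi>0: "\<phi> p i = 0" if "p \<in> U" "i \<ge> m" for p i
      using M.chart_in_Euclidean_space[OF c that(1)] that(2) by (simp add: topspace_Euclidean_space m_def)
    have \<psi>0: "\<psi> q i = 0" if "q \<in> V" "i \<ge> n" for q i
      using N.chart_in_Euclidean_space[OF d that(1)] that(2) by (simp add: topspace_Euclidean_space n_def)
    have \<pi>1\<Phi>: "\<pi>1 (\<Phi> (p, q)) = \<phi> p" if "p \<in> U" for p q
      using \<phi>0[OF that] by (auto simp: \<pi>1_def \<Phi> fun_eq_iff)
    have \<pi>2\<Phi>: "\<pi>2 (\<Phi> (p, q)) = \<psi> q" if "q \<in> V" for p q
      using \<psi>0[OF that] by (auto simp: \<pi>2_def \<Phi> fun_eq_iff)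
    have \<Phi>E: "\<Phi> z \<in> topspace ?E" if "z \<in> U \<times> V" for z
      using that \<psi>0 by (auto simp: \<Phi> topspace_Euclidean_space)
    have image: "\<Phi> ` (U \<times> V) = {x \<in> topspace ?E. \<pi>1 x \<in> \<phi> ` U} \<inter> {x \<in> topspace ?E. \<pi>2 x \<in> \<psi> ` V}"
    proof (intro subset_antisym subsetI)
      fix x assume "x \<in> \<Phi> ` (U \<times> V)"
      then show "x \<in> {x \<in> topspace ?E. \<pi>1 x \<in> \<phi> ` U} \<inter> {x \<in> topspace ?E. \<pi>2 x \<in> \<psi> ` V}"
        using \<Phi>E \<pi>1\<Phi> \<pi>2\<Phi> by auto
    next
      fix x assume "x \<in> {x \<in> topspace ?E. \<pi>1 x \<in> \<phi> ` U} \<inter> {x \<in> topspace ?E. \<pi>2 x \<in> \<psi> ` V}"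
      then obtain p q where x: "x \<in> topspace ?E" and pq: "p \<in> U" "\<pi>1 x = \<phi> p" "q \<in> V" "\<pi>2 x = \<psi> q" by blast
      have "x i = \<Phi> (p, q) i" for i
      proof (cases "i < m")
        case True
        then show ?thesis using fun_cong[OF pq(2), of i] by (simp add: \<pi>1_def \<Phi>)
      next
        case False
        then show ?thesis using fun_cong[OF pq(4), of "i - m"] x
          by (auto simp: \<pi>2_def \<Phi> topspace_Euclidean_space split: if_splits)
      qed
      then have "x = \<Phi> (p, q)" by blast
      then show "x \<in> \<Phi> ` (U \<times> V)" using pq by blast
    qed
    have "openin (prod_topology (mtop M) (mtop N)) (U \<times> V)"
      using M.open_domain[OF c] N.open_domain[OF d] by (simp add: openin_prod_Times_iff)
    moreover have "openin ?E (\<Phi> ` (U \<times> V))"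
      unfolding image using M.open_range[OF c] N.open_range[OF d]
      by (intro openin_Int openin_continuous_map_preimage[OF \<pi>1] openin_continuous_map_preimage[OF \<pi>2])
        (auto simp: m_def n_def)
    moreover have "homeomorphic_maps (subtopology (prod_topology (mtop M) (mtop N)) (U \<times> V))
        (subtopology ?E (\<Phi> ` (U \<times> V))) \<Phi> (\<lambda>x. (inv_into U \<phi> (\<pi>1 x), inv_into V \<psi> (\<pi>2 x)))"
      unfolding homeomorphic_maps_def
    proof (intro conjI ballI)
      let ?X = "subtopology (prod_topology (mtop M) (mtop N)) (U \<times> V)"
      have X: "?X = prod_topology (subtopology (mtop M) U) (subtopology (mtop N) V)"
        by (rule subtopology_Times)
      have "continuous_map ?X euclideanreal (\<lambda>z. \<phi> (fst z) i)" for i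
        unfolding X using continuous_map_compose[OF continuous_map_compose[OF continuous_map_fst
            M.continuous_chart[OF c]] continuous_map_Euclidean_space_coordinate[of _ i]]
        by (simp add: comp_def)
      moreover have "continuous_map ?X euclideanreal (\<lambda>z. \<psi> (snd z) i)" for i
        unfolding X using continuous_map_compose[OF continuous_map_compose[OF continuous_map_snd
            N.continuous_chart[OF d]] continuous_map_Euclidean_space_coordinate[of _ i]]
        by (simp add: comp_def)
      ultimately have "continuous_map ?X euclideanreal (\<lambda>z. \<Phi> z i)" for i
        by (cases "i < m") (simp_all add: \<Phi> case_prod_unfold)
      then have "continuous_map ?X ?E \<Phi>"
        using \<Phi>E by (intro continuous_map_into_Euclidean_space) (auto simp only: top)
      then show "continuous_map ?X (subtopology ?E (\<Phi> ` (U \<times> V))) \<Phi>"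
        by (simp add: continuous_map_in_subtopology top del: topspace_subtopology)
      let ?Y = "subtopology ?E (\<Phi> ` (U \<times> V))"
      have Y1: "continuous_map ?Y (subtopology (Euclidean_space m) (\<phi> ` U)) \<pi>1"
        using \<pi>1 \<pi>1\<Phi> by (auto simp: continuous_map_in_subtopology continuous_map_from_subtopology)
      have Y2: "continuous_map ?Y (subtopology (Euclidean_space n) (\<psi> ` V)) \<pi>2"
        using \<pi>2 \<pi>2\<Phi> by (auto simp: continuous_map_in_subtopology continuous_map_from_subtopology)
      show "continuous_map ?Y ?X (\<lambda>x. (inv_into U \<phi> (\<pi>1 x), inv_into V \<psi> (\<pi>2 x)))"
        unfolding X continuous_map_pairwise
        using continuous_map_compose[OF Y1[unfolded m_def] M.continuous_inv_chart[OF c]]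
          continuous_map_compose[OF Y2[unfolded n_def] N.continuous_inv_chart[OF d]]
        by (simp add: comp_def m_def n_def)
    next
      fix z assume "z \<in> topspace (subtopology (prod_topology (mtop M) (mtop N)) (U \<times> V))"
      then have "z \<in> U \<times> V" by (simp only: top)
      then show "(inv_into U \<phi> (\<pi>1 (\<Phi> z)), inv_into V \<psi> (\<pi>2 (\<Phi> z))) = z"
        using \<pi>1\<Phi> \<pi>2\<Phi> M.inv_chart[OF c] N.inv_chart[OF d] by auto
    next
      fix y assume "y \<in> topspace (subtopology ?E (\<Phi> ` (U \<times> V)))"
      then obtain p q where "p \<in> U" "q \<in> V" "y = \<Phi> (p, q)" by auto
      then show "\<Phi> (inv_into U \<phi> (\<pi>1 y), inv_into V \<psi> (\<pi>2 y)) = y"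
        using \<pi>1\<Phi> \<pi>2\<Phi> M.inv_chart[OF c] N.inv_chart[OF d] by simp
    qed
    ultimately show ?thesis using homeomorphic_map_maps by blast
  qed
  have elim: "\<exists>U \<phi> V \<psi>. (U, \<phi>) \<in> charts M \<and> (V, \<psi>) \<in> charts N \<and> S = U \<times> V \<and>
      \<Phi> = (\<lambda>(p, q) i. if i < m then \<phi> p i else \<psi> q (i - m))"
    if "(S, \<Phi>) \<in> charts (prod_manifold M N)" for S \<Phi>
    using that unfolding prod_manifold_def m_def by force
  have top: "mtop (prod_manifold M N) = prod_topology (mtop M) (mtop N)"
    and dim: "mdim (prod_manifold M N) = m + n" by (simp_all add: prod_manifold_def m_def n_def)
  show ?thesis
  proof
    fix p assume "p \<in> topspace (mtop (prod_manifold M N))"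
    then have "fst p \<in> topspace (mtop M)" "snd p \<in> topspace (mtop N)" by (auto simp: top)
    then obtain U \<phi> V \<psi> where *: "(U, \<phi>) \<in> charts M" "fst p \<in> U" "(V, \<psi>) \<in> charts N" "snd p \<in> V"
      using M.covered N.covered by meson
    have "(U \<times> V, \<lambda>(p, q) i. if i < mdim M then \<phi> p i else \<psi> q (i - mdim M)) \<in> charts (prod_manifold M N)"
      using * unfolding prod_manifold_def by force
    moreover have "p \<in> U \<times> V" using * by (cases p) auto
    ultimately show "\<exists>U \<phi>. (U, \<phi>) \<in> charts (prod_manifold M N) \<and> p \<in> U" by blast
  qed (unfold top dim; use elim charts in blast)+
qed

subsection \<open>Curves\<close>

abbreviation real_chart :: "real \<Rightarrow> nat \<Rightarrow> real" where
  "real_chart \<equiv> \<lambda>t i. if i = 0 then t else 0"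

lemma range_real_chart: "range real_chart = topspace (Euclidean_space 1)"
proof (intro subset_antisym subsetI)
  fix x :: "nat \<Rightarrow> real" assume "x \<in> topspace (Euclidean_space 1)"
  then have "x = real_chart (x 0)" by (auto simp: topspace_Euclidean_space fun_eq_iff)
  then show "x \<in> range real_chart" by blast
qed (auto simp: topspace_Euclidean_space)

lemma inv_real_chart: "inv_into UNIV real_chart (real_chart t) = t"
proof (rule inv_into_f_f)
  show "inj real_chart" by (rule injI) (metis)
qed simp

lemma charted_space_real_line: "charted_space real_line"
proof
  fix U \<phi> assume "(U, \<phi>) \<in> charts real_line"
  then have U: "U = UNIV" "\<phi> = real_chart" by (auto simp: real_line_def)
  show "openin (mtop real_line) U" by (simp add: U real_line_def)
  show "openin (Euclidean_space (mdim real_line)) (\<phi> ` U)"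
    using range_real_chart openin_topspace by (simp add: U real_line_def)
  have "homeomorphic_maps euclideanreal (Euclidean_space 1) real_chart (\<lambda>x. x 0)"
    unfolding homeomorphic_maps_def
  proof (intro conjI ballI)
    show "continuous_map euclideanreal (Euclidean_space 1) real_chart"
      by (rule continuous_map_into_Euclidean_space) (auto simp: topspace_Euclidean_space)
  qed (auto simp: continuous_map_Euclidean_space_coordinate topspace_Euclidean_space fun_eq_iff)
  then show "homeomorphic_map (subtopology (mtop real_line) U)
      (subtopology (Euclidean_space (mdim real_line)) (\<phi> ` U)) \<phi>"
    using range_real_chart by (auto simp: U real_line_def homeomorphic_map_maps)
qed (auto simp: real_line_def)

lemma smooth_map_real_line_scale: "smooth_map real_line real_line (\<lambda>t. c * t)"
proof -
  have "smooth_on 1 (range real_chart) (\<lambda>x. real_chart (c * inv_into UNIV real_chart x) 0)"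
  proof (rule smooth_on_cong)
    show "openin (Euclidean_space 1) (range real_chart)"
      unfolding range_real_chart by simp
    show "c * x 0 = real_chart (c * inv_into UNIV real_chart x) 0" if x: "x \<in> range real_chart" for x
    proof -
      obtain t where t: "x = real_chart t" using x by blast
      show ?thesis unfolding t inv_real_chart by simp
    qed
    show "smooth_on 1 (range real_chart) (\<lambda>x. c * x 0)"
      unfolding smooth_on_def range_real_chart
      by (auto intro: Ck_on_mult Ck_on_const Ck_on_coordinate)
  qed
  then show ?thesis
    by (auto simp: smooth_map_def real_line_def intro: continuous_intros)
qed

lemma smooth_curve_differentiable:
  assumes \<gamma>: "smooth_map real_line M \<gamma>" and c: "(U, \<phi>) \<in> charts M" and i: "i < mdim M" and t: "\<gamma> t \<in> U"
  shows "(\<lambda>t. \<phi> (\<gamma> t) i) differentiable (at t)"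
proof -
  have "(UNIV, real_chart) \<in> charts real_line" by (simp add: real_line_def)
  from smooth_map_in_charts[OF \<gamma> this c i]
  have "Ck_on 1 (Suc 0) (real_chart ` {s. \<gamma> s \<in> U}) (\<lambda>x. \<phi> (\<gamma> (inv_into UNIV real_chart x)) i)"
    unfolding smooth_on_def by (simp only: real_line_def manifold.simps UNIV_I simp_thms)
  from has_real_derivative_partial_deriv[OF this, of "real_chart t" 0]
  have "(\<lambda>s. \<phi> (\<gamma> (inv_into UNIV real_chart ((real_chart t)(0 := s)))) i) differentiable (at (real_chart t 0))"
    using t by (auto simp: real_differentiable_def simp del: fun_upd_apply)
  moreover have "(real_chart t)(0 := s) = real_chart s" for s by auto
  ultimately show ?thesis by (simp only: inv_real_chart if_True simp_thms)
qed

section \<open>The Lie algebra in a chart at the identity\<close>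

lemma sum_lessThan_add: "(\<Sum>i<m + n. f i) = (\<Sum>i<m. f i) + (\<Sum>i<n. f (m + i))"
  for f :: "nat \<Rightarrow> 'a::comm_monoid_add"
  by (induction n) (simp_all add: add.assoc)

lemma has_real_derivative_cong_nhds:
  "\<lbrakk>(f has_real_derivative D) (at a); \<forall>\<^sub>F t in nhds a. f t = g t\<rbrakk> \<Longrightarrow> (g has_real_derivative D) (at a)"
  using DERIV_cong_ev[of a a f g D D] by simp

context lie_group
begin

lemma curve_in_carrier: "smooth_map real_line M \<gamma> \<Longrightarrow> \<gamma> t \<in> carrier G"
  using smooth_map_continuous[of real_line M \<gamma>] by (auto simp: continuous_map_def real_line_def carrier_eq)

lemma smooth_map_mult:
  assumes "charted_space K" "smooth_map K M \<alpha>" "smooth_map K M \<beta>"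
  shows "smooth_map K M (\<lambda>x. \<alpha> x \<otimes> \<beta> x)"
  using smooth_map_compose[OF assms(1) charted_space_prod[OF charted_space charted_space] charted_space
      smooth_map_pair[OF assms(2,3)] smooth_mult] by simp

lemma smooth_map_conj:
  assumes "g \<in> carrier G"
  shows "smooth_map M M (\<lambda>x. g \<otimes> x \<otimes> inv g)"
  using assms by (intro smooth_map_mult charted_space smooth_map_const smooth_map_id) (auto simp: carrier_eq)

lemma smooth_curve_conj:
  assumes "g \<in> carrier G" "smooth_map real_line M \<gamma>"
  shows "smooth_map real_line M (\<lambda>t. g \<otimes> \<gamma> t \<otimes> inv g)"
  by (rule smooth_map_compose[OF charted_space_real_line charted_space charted_space assms(2) smooth_map_conj[OF assms(1)]])

lemma lie_algebraI: "\<lbrakk>smooth_map real_line M \<gamma>; \<gamma> 0 = \<one>\<rbrakk> \<Longrightarrow> velocity M \<gamma> \<in> lie_algebra G M"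
  by (auto simp: lie_algebra_def tangent_space_def)

lemma lie_algebraE:
  assumes "X \<in> lie_algebra G M"
  obtains \<gamma> where "smooth_map real_line M \<gamma>" "\<gamma> 0 = \<one>" "X = velocity M \<gamma>"
  using assms by (auto simp: lie_algebra_def tangent_space_def)

lemma velocity_const: "velocity M (\<lambda>_. p) = (\<lambda>f. 0)"
  by (auto simp: velocity_def)

lemma zero_in_lie_subalgebra: "\<one> \<in> H \<Longrightarrow> (\<lambda>f. 0) \<in> lie_subalgebra G M H"
  unfolding lie_subalgebra_def velocity_const[of \<one>, symmetric]
  using smooth_map_const[of \<one> M real_line] by (auto simp: carrier_eq)

text \<open>
  Both sides vanish on functions that are not smooth near the identity, and conjugation preserves
  smoothness near the identity.
\<close>

lemma Ad_velocity:
  assumes g: "g \<in> carrier G" and \<gamma>: "smooth_map real_line M \<gamma>" "\<gamma> 0 = \<one>"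
  shows "Ad G M g (velocity M \<gamma>) = velocity M (\<lambda>t. g \<otimes> \<gamma> t \<otimes> inv g)"
proof
  fix f
  have 1: "g \<otimes> \<one> \<otimes> inv g = \<one>" using g by simp
  have "smooth_near M \<one> (\<lambda>q. f (g \<otimes> q \<otimes> inv g))" if "smooth_near M \<one> f"
    by (rule smooth_near_compose[OF charted_space charted_space smooth_map_conj[OF g]])
      (use that 1 in \<open>auto simp: carrier_eq\<close>)
  then show "Ad G M g (velocity M \<gamma>) f = velocity M (\<lambda>t. g \<otimes> \<gamma> t \<otimes> inv g) f"
    by (simp add: Ad_def differential_def velocity_def 1 \<gamma>(2))
qed

lemma Ad_in_lie_algebra: "\<lbrakk>g \<in> carrier G; X \<in> lie_algebra G M\<rbrakk> \<Longrightarrow> Ad G M g X \<in> lie_algebra G M"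
  by (elim lie_algebraE) (simp add: Ad_velocity lie_algebraI smooth_curve_conj)

lemma Ad_mult:
  assumes "g \<in> carrier G" "h \<in> carrier G" "X \<in> lie_algebra G M"
  shows "Ad G M g (Ad G M h X) = Ad G M (g \<otimes> h) X"
proof -
  obtain \<gamma> where \<gamma>: "smooth_map real_line M \<gamma>" "\<gamma> 0 = \<one>" "X = velocity M \<gamma>"
    using assms(3) by (rule lie_algebraE)
  have "g \<otimes> (h \<otimes> \<gamma> t \<otimes> inv h) \<otimes> inv g = g \<otimes> h \<otimes> \<gamma> t \<otimes> inv (g \<otimes> h)" for t
    using assms curve_in_carrier[OF \<gamma>(1), of t] by (simp add: m_assoc inv_mult_group)
  then show ?thesis
    using assms \<gamma>(2) by (simp add: \<gamma>(3) Ad_velocity \<gamma>(1) smooth_curve_conj)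
qed

lemma Ad_one: "X \<in> lie_algebra G M \<Longrightarrow> Ad G M \<one> X = X"
  by (elim lie_algebraE) (simp add: Ad_velocity curve_in_carrier)

lemma Ad_add: "Ad G M g (\<lambda>f. X f + Y f) = (\<lambda>f. Ad G M g X f + Ad G M g Y f)"
  by (auto simp: Ad_def differential_def)

lemma Ad_scale: "Ad G M g (\<lambda>f. c * X f) = (\<lambda>f. c * Ad G M g X f)"
  by (auto simp: Ad_def differential_def)

end

locale lie_group_chart = lie_group +
  fixes U and \<phi>
  assumes chart: "(U, \<phi>) \<in> charts M" and one_in_U: "\<one> \<in> U"
begin

sublocale charted_space M by (rule charted_space)

abbreviation dim :: nat where "dim \<equiv> mdim M"

lemma U_subset: "U \<subseteq> carrier G"
  using domain_subset[OF chart] by (simp add: carrier_eq)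

lemma curve_eventually_in_U:
  assumes "smooth_map real_line M \<gamma>" "\<gamma> 0 = \<one>"
  shows "\<forall>\<^sub>F t in nhds 0. \<gamma> t \<in> U"
proof -
  have "openin (mtop real_line) {t \<in> topspace (mtop real_line). \<gamma> t \<in> U}"
    using openin_continuous_map_preimage[OF smooth_map_continuous[OF assms(1)] open_domain[OF chart]] .
  then have "open {t. \<gamma> t \<in> U}" by (simp add: real_line_def)
  then show ?thesis
    unfolding eventually_nhds using assms(2) one_in_U by (intro exI[of _ "{t. \<gamma> t \<in> U}"]) auto
qed

lemma coordinate_smooth_near: "i < dim \<Longrightarrow> smooth_near M \<one> (\<lambda>p. \<phi> p i)"
  unfolding smooth_near_def using chart one_in_U open_domain[OF chart] charts_compatible[OF _ chart]
  by (intro exI[of _ U]) auto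

lemma velocity_coordinate: "\<lbrakk>i < dim; \<gamma> 0 = \<one>\<rbrakk> \<Longrightarrow> velocity M \<gamma> (\<lambda>p. \<phi> p i) = deriv (\<lambda>t. \<phi> (\<gamma> t) i) 0"
  by (simp add: velocity_def coordinate_smooth_near)

lemma curve_coordinate_derivative:
  assumes "smooth_map real_line M \<gamma>" "\<gamma> 0 = \<one>" "i < dim"
  shows "((\<lambda>t. \<phi> (\<gamma> t) i) has_real_derivative velocity M \<gamma> (\<lambda>p. \<phi> p i)) (at 0)"
  unfolding velocity_coordinate[of i \<gamma>, OF assms(3,2)]
  using smooth_curve_differentiable[OF assms(1) chart assms(3), of 0] assms(2) one_in_U
  by (simp add: DERIV_deriv_iff_real_differentiable)

lemma curve_derivative:
  assumes \<gamma>: "smooth_map real_line M \<gamma>" "\<gamma> 0 = \<one>" and f: "smooth_near M \<one> f"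
  shows "((\<lambda>t. f (\<gamma> t)) has_real_derivative
    (\<Sum>i<dim. partial_deriv i (\<lambda>x. f (inv_into U \<phi> x)) (\<phi> \<one>) * velocity M \<gamma> (\<lambda>p. \<phi> p i))) (at 0)"
proof -
  obtain W where W: "\<one> \<in> W" "openin (mtop M) W"
    and smooth: "smooth_on dim (\<phi> ` (U \<inter> W)) (\<lambda>x. f (inv_into U \<phi> x))"
    using f chart unfolding smooth_near_def by blast
  have "((\<lambda>t. f (inv_into U \<phi> (\<phi> (\<gamma> t)))) has_real_derivative
    (\<Sum>i<dim. partial_deriv i (\<lambda>x. f (inv_into U \<phi> x)) (\<phi> (\<gamma> 0)) * velocity M \<gamma> (\<lambda>p. \<phi> p i))) (at 0)"
  proof (rule C1_chain_rule)
    show "openin (Euclidean_space dim) (\<phi> ` (U \<inter> W))"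
      using open_domain[OF chart] W(2) by (intro open_chart_image[OF chart]) auto
    show "Ck_on dim (Suc 0) (\<phi> ` (U \<inter> W)) (\<lambda>x. f (inv_into U \<phi> x))"
      using smooth unfolding smooth_on_def by blast
    show "\<phi> (\<gamma> 0) \<in> \<phi> ` (U \<inter> W)" using \<gamma>(2) one_in_U W(1) by auto
    show "\<forall>\<^sub>F t in nhds 0. \<phi> (\<gamma> t) \<in> topspace (Euclidean_space dim)"
      using curve_eventually_in_U[OF \<gamma>] by eventually_elim (rule chart_in_Euclidean_space[OF chart])
  qed (rule curve_coordinate_derivative[OF \<gamma>])
  moreover have "\<forall>\<^sub>F t in nhds 0. f (inv_into U \<phi> (\<phi> (\<gamma> t))) = f (\<gamma> t)"
    using curve_eventually_in_U[OF \<gamma>] by eventually_elim (simp add: inv_chart[OF chart])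
  ultimately show ?thesis unfolding \<gamma>(2) by (rule has_real_derivative_cong_nhds)
qed

text \<open>
  By the chain rule a tangent vector is determined by its values on the \<open>dim\<close> coordinate functions.
  In this form the finite dimension of the Lie algebra enters the norm estimates.
\<close>

lemma lie_algebra_expand:
  assumes "X \<in> lie_algebra G M"
  shows "X f = (if smooth_near M \<one> f
    then \<Sum>i<dim. partial_deriv i (\<lambda>x. f (inv_into U \<phi> x)) (\<phi> \<one>) * X (\<lambda>p. \<phi> p i) else 0)"
  using assms
proof (rule lie_algebraE)
  fix \<gamma> assume \<gamma>: "smooth_map real_line M \<gamma>" "\<gamma> 0 = \<one>" "X = velocity M \<gamma>"
  show ?thesis
    using DERIV_imp_deriv[OF curve_derivative[OF \<gamma>(1,2)], of f] \<gamma>(2) by (simp add: \<gamma>(3) velocity_def)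
qed

lemma lie_algebra_eqI:
  assumes "X \<in> lie_algebra G M" "Y \<in> lie_algebra G M" "\<And>i. i < dim \<Longrightarrow> X (\<lambda>p. \<phi> p i) = Y (\<lambda>p. \<phi> p i)"
  shows "X = Y"
  using lie_algebra_expand[OF assms(1)] lie_algebra_expand[OF assms(2)] assms(3) by (simp add: fun_eq_iff)

subsection \<open>Multiplication in the chart\<close>

definition pair_chart :: "'a \<times> 'a \<Rightarrow> nat \<Rightarrow> real" where
  "pair_chart = (\<lambda>(p, q) i. if i < dim then \<phi> p i else \<phi> q (i - dim))"

definition mult_coordinate :: "nat \<Rightarrow> (nat \<Rightarrow> real) \<Rightarrow> real" where
  "mult_coordinate j x = \<phi> ((\<lambda>(p, q). p \<otimes> q) (inv_into (U \<times> U) pair_chart x)) j"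

definition mult_domain :: "(nat \<Rightarrow> real) set" where
  "mult_domain = pair_chart ` {z \<in> U \<times> U. (\<lambda>(p, q). p \<otimes> q) z \<in> U}"

lemma pair_chart_fst: "i < dim \<Longrightarrow> pair_chart (p, q) i = \<phi> p i"
  by (simp add: pair_chart_def)

lemma pair_chart_snd: "pair_chart (p, q) (dim + i) = \<phi> q i"
  by (simp add: pair_chart_def)

lemma pair_chart_in_charts: "(U \<times> U, pair_chart) \<in> charts (prod_manifold M M)"
  using chart unfolding prod_manifold_def pair_chart_def by force

lemma mdim_prod: "mdim (prod_manifold M M) = dim + dim"
  by (simp add: prod_manifold_def)

lemma inv_pair_chart: "z \<in> U \<times> U \<Longrightarrow> inv_into (U \<times> U) pair_chart (pair_chart z) = z"
  using charted_space.inv_chart[OF charted_space_prod[OF charted_space charted_space] pair_chart_in_charts] .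

lemma mult_coordinate_pair_chart:
  "\<lbrakk>p \<in> U; q \<in> U\<rbrakk> \<Longrightarrow> mult_coordinate j (pair_chart (p, q)) = \<phi> (p \<otimes> q) j"
  by (simp add: mult_coordinate_def inv_pair_chart)

lemma pair_chart_in_Euclidean_space:
  "z \<in> U \<times> U \<Longrightarrow> pair_chart z \<in> topspace (Euclidean_space (dim + dim))"
  using charted_space.chart_in_Euclidean_space[OF charted_space_prod[OF charted_space charted_space] pair_chart_in_charts]
  by (simp add: mdim_prod)

lemma open_mult_domain: "openin (Euclidean_space (dim + dim)) mult_domain"
proof -
  interpret P: charted_space "prod_manifold M M" by (rule charted_space_prod[OF charted_space charted_space])
  show ?thesis
    unfolding mult_domain_def mdim_prod[symmetric]
    using openin_preimage_in_domain[OF P.open_domain[OF pair_chart_in_charts] smooth_map_continuous[OF smooth_mult]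
        open_domain[OF chart]]
    by (intro P.open_chart_image[OF pair_chart_in_charts]) auto
qed

lemma C1_mult_coordinate:
  assumes "j < dim"
  shows "Ck_on (dim + dim) (Suc 0) mult_domain (mult_coordinate j)"
  using smooth_map_in_charts[OF smooth_mult pair_chart_in_charts chart assms]
  unfolding mult_domain_def mult_coordinate_def[abs_def] smooth_on_def mdim_prod by blast

lemma one_in_mult_domain: "pair_chart (\<one>, \<one>) \<in> mult_domain"
  unfolding mult_domain_def using one_in_U by force

text \<open>The derivative of multiplication at the identity is addition, because \<open>a \<one> = \<one> a = a\<close>.\<close>

lemma partial_deriv_mult_coordinate:
  assumes i: "i < dim + dim"
  shows "partial_deriv i (mult_coordinate j) (pair_chart (\<one>, \<one>)) = (if i = j \<and> i < dim \<or> i = dim + j then 1 else 0)"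
proof -
  let ?p = "pair_chart (\<one>, \<one>)"
  \<comment> \<open>The \<open>i\<close>-th coordinate line through the pair of identities moves one factor along its \<open>k\<close>-th
    coordinate and leaves the other at the identity.\<close>
  define k where "k = (if i < dim then i else i - dim)"
  have k: "k < dim" using i by (auto simp: k_def)
  have pi: "?p i = \<phi> \<one> k" by (simp add: pair_chart_def k_def)
  have "\<forall>\<^sub>F t in nhds (\<phi> \<one> k). (\<phi> \<one>)(k := t) \<in> \<phi> ` U"
    by (rule eventually_fun_upd_in[OF open_range[OF chart] _ k]) (use one_in_U in auto)
  then have "\<forall>\<^sub>F t in nhds (\<phi> \<one> k). mult_coordinate j (?p(i := t)) = ((\<phi> \<one>)(k := t)) j"
  proof eventually_elim
    case (elim t)
    then obtain q where q: "q \<in> U" "\<phi> q = (\<phi> \<one>)(k := t)" by auto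
    then have "q \<in> carrier G" using U_subset by blast
    show ?case
    proof (cases "i < dim")
      case True
      have "?p(i := t) = pair_chart (q, \<one>)"
        using True q by (auto simp: pair_chart_def k_def fun_eq_iff)
      then show ?thesis using q one_in_U \<open>q \<in> carrier G\<close> by (simp only: mult_coordinate_pair_chart r_one)
    next
      case False
      have "?p(i := t) = pair_chart (\<one>, q)"
        using False q by (auto simp: pair_chart_def k_def fun_eq_iff)
      then show ?thesis using q one_in_U \<open>q \<in> carrier G\<close> by (simp only: mult_coordinate_pair_chart l_one)
    qed
  qed
  then have "partial_deriv i (mult_coordinate j) ?p = deriv (\<lambda>t. ((\<phi> \<one>)(k := t)) j) (\<phi> \<one> k)"
    unfolding partial_deriv_def pi by (intro deriv_cong_ev) auto
  also have "\<dots> = (if j = k then 1 else 0)" by simp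
  also have "\<dots> = (if i = j \<and> i < dim \<or> i = dim + j then 1 else 0)"
    using i by (auto simp: k_def)
  finally show ?thesis .
qed

lemma sum_partial_deriv_mult_coordinate:
  assumes "j < dim"
  shows "(\<Sum>i<dim + dim. partial_deriv i (mult_coordinate j) (pair_chart (\<one>, \<one>)) * v i) = v j + v (dim + j)"
proof -
  have "(\<Sum>i<dim + dim. partial_deriv i (mult_coordinate j) (pair_chart (\<one>, \<one>)) * v i)
      = (\<Sum>i<dim + dim. (if i = j then v i else 0) + (if i = dim + j then v i else 0))"
    using assms by (intro sum.cong) (auto simp: partial_deriv_mult_coordinate)
  also have "\<dots> = v j + v (dim + j)"
    using assms by (simp add: sum.distrib)
  finally show ?thesis .
qed

lemma velocity_mult_coordinate:
  assumes \<alpha>: "smooth_map real_line M \<alpha>" "\<alpha> 0 = \<one>" and \<beta>: "smooth_map real_line M \<beta>" "\<beta> 0 = \<one>" and j: "j < dim"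
  shows "velocity M (\<lambda>t. \<alpha> t \<otimes> \<beta> t) (\<lambda>p. \<phi> p j) = velocity M \<alpha> (\<lambda>p. \<phi> p j) + velocity M \<beta> (\<lambda>p. \<phi> p j)"
proof -
  define c' where "c' i = (if i < dim then velocity M \<alpha> (\<lambda>p. \<phi> p i) else velocity M \<beta> (\<lambda>p. \<phi> p (i - dim)))" for i
  have ev: "\<forall>\<^sub>F t in nhds 0. (\<alpha> t, \<beta> t) \<in> U \<times> U"
    using curve_eventually_in_U[OF \<alpha>] curve_eventually_in_U[OF \<beta>] by eventually_elim simp
  have D: "((\<lambda>t. mult_coordinate j (pair_chart (\<alpha> t, \<beta> t))) has_real_derivative
      (\<Sum>i<dim + dim. partial_deriv i (mult_coordinate j) (pair_chart (\<alpha> 0, \<beta> 0)) * c' i)) (at 0)"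
  proof (rule C1_chain_rule[OF open_mult_domain C1_mult_coordinate[OF j]])
    show "pair_chart (\<alpha> 0, \<beta> 0) \<in> mult_domain" using \<alpha> \<beta> one_in_mult_domain by simp
    show "\<forall>\<^sub>F t in nhds 0. pair_chart (\<alpha> t, \<beta> t) \<in> topspace (Euclidean_space (dim + dim))"
      using ev by eventually_elim (rule pair_chart_in_Euclidean_space)
    show "((\<lambda>t. pair_chart (\<alpha> t, \<beta> t) i) has_real_derivative c' i) (at 0)" if "i < dim + dim" for i
      using that curve_coordinate_derivative[OF \<alpha>, of i] curve_coordinate_derivative[OF \<beta>, of "i - dim"]
      by (cases "i < dim") (simp_all add: pair_chart_def c'_def)
  qed
  have sum: "(\<Sum>i<dim + dim. partial_deriv i (mult_coordinate j) (pair_chart (\<alpha> 0, \<beta> 0)) * c' i)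
      = velocity M \<alpha> (\<lambda>p. \<phi> p j) + velocity M \<beta> (\<lambda>p. \<phi> p j)"
    using j sum_partial_deriv_mult_coordinate[OF j, of c'] by (simp add: \<alpha> \<beta> c'_def)
  have "\<forall>\<^sub>F t in nhds 0. mult_coordinate j (pair_chart (\<alpha> t, \<beta> t)) = \<phi> (\<alpha> t \<otimes> \<beta> t) j"
    using ev by eventually_elim (simp add: mult_coordinate_pair_chart)
  then have "((\<lambda>t. \<phi> (\<alpha> t \<otimes> \<beta> t) j) has_real_derivative
      velocity M \<alpha> (\<lambda>p. \<phi> p j) + velocity M \<beta> (\<lambda>p. \<phi> p j)) (at 0)"
    by (rule has_real_derivative_cong_nhds[OF D[unfolded sum]])
  then show ?thesis
    using velocity_coordinate[OF j, of "\<lambda>t. \<alpha> t \<otimes> \<beta> t"] by (simp add: \<alpha> \<beta> DERIV_imp_deriv)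
qed

text \<open>
  The \<open>l\<^sup>1\<close> distance of coordinates. Outside \<open>U\<close> its value is meaningless, so the balls below are taken
  inside \<open>U\<close>.
\<close>

definition chart_dist :: "'a \<Rightarrow> 'a \<Rightarrow> real" where
  "chart_dist a b = (\<Sum>i<dim. \<bar>\<phi> a i - \<phi> b i\<bar>)"

definition chart_ball :: "real \<Rightarrow> 'a set" where
  "chart_ball r = {a \<in> U. chart_dist a \<one> < r}"

lemma chart_dist_nonneg: "chart_dist a b \<ge> 0"
  by (simp add: chart_dist_def sum_nonneg)

lemma chart_dist_same: "chart_dist a a = 0"
  by (simp add: chart_dist_def)

lemma chart_dist_triangle: "chart_dist a c \<le> chart_dist a b + chart_dist b c"
  unfolding chart_dist_def sum.distrib[symmetric] by (rule sum_mono) simp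

lemma coordinate_le_chart_dist: "i < dim \<Longrightarrow> \<bar>\<phi> a i - \<phi> b i\<bar> \<le> chart_dist a b"
  unfolding chart_dist_def by (rule member_le_sum) auto

lemma one_in_chart_ball: "r > 0 \<Longrightarrow> \<one> \<in> chart_ball r"
  by (simp add: chart_ball_def one_in_U chart_dist_same)

text \<open>
  This is strict differentiability at the identity, where the derivative is addition, for all
  coordinates at once. The estimates for powers follow from it by the triangle inequality.
\<close>

lemma mult_strict_derivative:
  assumes e: "e > 0"
  obtains r where "r > 0"
    "\<And>a b a' b'. \<lbrakk>a \<in> chart_ball r; b \<in> chart_ball r; a' \<in> chart_ball r; b' \<in> chart_ball r\<rbrakk> \<Longrightarrow> a \<otimes> b \<in> U \<and>
      (\<Sum>j<dim. \<bar>(\<phi> (a \<otimes> b) j - \<phi> (a' \<otimes> b') j) - ((\<phi> a j - \<phi> a' j) + (\<phi> b j - \<phi> b' j))\<bar>)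
        \<le> e * (chart_dist a a' + chart_dist b b')"
proof -
  let ?p = "pair_chart (\<one>, \<one>)"
  let ?T = "topspace (Euclidean_space (dim + dim))"
  \<comment> \<open>The errors of the \<open>dim\<close> coordinates add up; the summand 1 covers dimension 0.\<close>
  define e' where "e' = e / (real dim + 1)"
  have e': "e' > 0" using e by (simp add: e'_def)
  define close where "close \<delta> x \<longleftrightarrow> (\<forall>i<dim + dim. \<bar>x i - ?p i\<bar> < \<delta>)" for \<delta> and x :: "nat \<Rightarrow> real"
  define strict where "strict j \<delta> \<longleftrightarrow> (\<forall>x\<in>?T. \<forall>y\<in>?T. close \<delta> x \<longrightarrow> close \<delta> y \<longrightarrow>
       \<bar>mult_coordinate j x - mult_coordinate j y - (\<Sum>i<dim + dim. partial_deriv i (mult_coordinate j) ?p * (x i - y i))\<bar>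
         \<le> e' * (\<Sum>i<dim + dim. \<bar>x i - y i\<bar>))" for j \<delta>
  have "\<exists>\<delta>>0. strict j \<delta>" if "j < dim" for j
    unfolding strict_def close_def
    by (rule C1_strict_derivative[OF open_mult_domain C1_mult_coordinate[OF that] one_in_mult_domain e'])
      (intro exI conjI; assumption)
  then obtain d where d: "\<And>j. j < dim \<Longrightarrow> d j > 0" and strict: "\<And>j. j < dim \<Longrightarrow> strict j (d j)"
    by metis
  obtain d0 where d0: "d0 > 0" "\<forall>x\<in>?T. (\<forall>i<dim + dim. \<bar>x i - ?p i\<bar> < d0) \<longrightarrow> x \<in> mult_domain"
    by (rule openin_Euclidean_space_box[OF open_mult_domain one_in_mult_domain]) (rule that)
  define r where "r = Min (insert d0 (d ` {..<dim}))"
  have r: "r > 0" "r \<le> d0" "\<And>j. j < dim \<Longrightarrow> r \<le> d j"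
    unfolding r_def using d d0 by auto
  have box: "\<bar>pair_chart (a, b) i - ?p i\<bar> < r" if "a \<in> chart_ball r" "b \<in> chart_ball r" "i < dim + dim" for a b i
  proof (cases "i < dim")
    case True
    then show ?thesis
      using that coordinate_le_chart_dist[of i a \<one>] by (auto simp: pair_chart_def chart_ball_def)
  next
    case False
    then have "i - dim < dim" using that(3) by simp
    from coordinate_le_chart_dist[OF this, of b \<one>] show ?thesis
      using False that by (auto simp: pair_chart_def chart_ball_def)
  qed
  show thesis
  proof (rule that[OF r(1)], intro conjI)
    fix a b a' b' assume ab: "a \<in> chart_ball r" "b \<in> chart_ball r" and ab': "a' \<in> chart_ball r" "b' \<in> chart_ball r"
    have U: "a \<in> U" "b \<in> U" "a' \<in> U" "b' \<in> U" using ab ab' by (auto simp: chart_ball_def)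
    have in_T: "pair_chart (a, b) \<in> ?T" "pair_chart (a', b') \<in> ?T"
      using U by (auto intro!: pair_chart_in_Euclidean_space)
    have "pair_chart (a, b) \<in> mult_domain"
      using box[OF ab] r(2) by (intro d0(2)[rule_format] in_T(1)) (auto intro: less_le_trans)
    then obtain z where z: "z \<in> U \<times> U" "(\<lambda>(p, q). p \<otimes> q) z \<in> U" "pair_chart (a, b) = pair_chart z"
      unfolding mult_domain_def by blast
    then have "z = (a, b)" using inv_pair_chart[of z] inv_pair_chart[of "(a, b)"] U by simp
    then show "a \<otimes> b \<in> U" using z by simp
    have sum: "(\<Sum>i<dim + dim. \<bar>pair_chart (a, b) i - pair_chart (a', b') i\<bar>) = chart_dist a a' + chart_dist b b'"
      by (simp add: sum_lessThan_add chart_dist_def pair_chart_def)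
    have "\<bar>(\<phi> (a \<otimes> b) j - \<phi> (a' \<otimes> b') j) - ((\<phi> a j - \<phi> a' j) + (\<phi> b j - \<phi> b' j))\<bar> \<le> e' * (chart_dist a a' + chart_dist b b')"
      if j: "j < dim" for j
    proof -
      have "\<bar>mult_coordinate j (pair_chart (a, b)) - mult_coordinate j (pair_chart (a', b'))
          - (\<Sum>i<dim + dim. partial_deriv i (mult_coordinate j) ?p * (pair_chart (a, b) i - pair_chart (a', b') i))\<bar>
         \<le> e' * (\<Sum>i<dim + dim. \<bar>pair_chart (a, b) i - pair_chart (a', b') i\<bar>)"
      proof (rule strict[OF j, unfolded strict_def, rule_format])
        show "close (d j) (pair_chart (a, b))" "close (d j) (pair_chart (a', b'))"
          unfolding close_def using box[OF ab] box[OF ab'] r(3)[OF j] by (auto intro: less_le_trans)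
      qed (use in_T in auto)
      then show ?thesis
        using j U unfolding sum sum_partial_deriv_mult_coordinate[OF j]
        by (simp add: mult_coordinate_pair_chart pair_chart_fst pair_chart_snd)
    qed
    then have "(\<Sum>j<dim. \<bar>(\<phi> (a \<otimes> b) j - \<phi> (a' \<otimes> b') j) - ((\<phi> a j - \<phi> a' j) + (\<phi> b j - \<phi> b' j))\<bar>)
        \<le> (\<Sum>j<dim. e' * (chart_dist a a' + chart_dist b b'))"
      by (intro sum_mono) auto
    also have "\<dots> = real dim * e' * (chart_dist a a' + chart_dist b b')" by simp
    also have "\<dots> \<le> e * (chart_dist a a' + chart_dist b b')"
      using e chart_dist_nonneg by (intro mult_right_mono) (auto simp: e'_def field_simps)
    finally show "(\<Sum>j<dim. \<bar>(\<phi> (a \<otimes> b) j - \<phi> (a' \<otimes> b') j) - ((\<phi> a j - \<phi> a' j) + (\<phi> b j - \<phi> b' j))\<bar>)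
        \<le> e * (chart_dist a a' + chart_dist b b')" .
  qed
qed

end

context lie_group
begin

lemma obtain_chart_at_one:
  obtains U \<phi> where "lie_group_chart G M U \<phi>"
proof -
  interpret charted_space M by (rule charted_space)
  obtain U \<phi> where "(U, \<phi>) \<in> charts M" "\<one> \<in> U" using covered[of \<one>] by (auto simp: carrier_eq)
  then have "lie_group_chart G M U \<phi>" by unfold_locales
  then show thesis by (rule that)
qed

text \<open>
  Sums in the Lie algebra come from products of curves, which are again globally defined smooth curves.
\<close>

lemma velocity_mult:
  assumes \<alpha>: "smooth_map real_line M \<alpha>" "\<alpha> 0 = \<one>" and \<beta>: "smooth_map real_line M \<beta>" "\<beta> 0 = \<one>"
  shows "velocity M (\<lambda>t. \<alpha> t \<otimes> \<beta> t) = (\<lambda>f. velocity M \<alpha> f + velocity M \<beta> f)"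
proof
  fix f
  obtain U \<phi> where "lie_group_chart G M U \<phi>" by (rule obtain_chart_at_one)
  then interpret lie_group_chart G M U \<phi> .
  have "velocity M (\<lambda>t. \<alpha> t \<otimes> \<beta> t) \<in> lie_algebra G M"
    using assms by (intro lie_algebraI smooth_map_mult charted_space_real_line) auto
  from lie_algebra_expand[OF this, of f] show "velocity M (\<lambda>t. \<alpha> t \<otimes> \<beta> t) f = velocity M \<alpha> f + velocity M \<beta> f"
    using lie_algebra_expand[OF lie_algebraI[OF \<alpha>], of f] lie_algebra_expand[OF lie_algebraI[OF \<beta>], of f]
    by (simp add: velocity_mult_coordinate[OF \<alpha> \<beta>] distrib_left sum.distrib)
qed

lemma lie_algebra_add:
  assumes "X \<in> lie_algebra G M" "Y \<in> lie_algebra G M"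
  shows "(\<lambda>f. X f + Y f) \<in> lie_algebra G M"
proof -
  obtain \<alpha> where \<alpha>: "smooth_map real_line M \<alpha>" "\<alpha> 0 = \<one>" "X = velocity M \<alpha>"
    using assms(1) by (rule lie_algebraE)
  obtain \<beta> where \<beta>: "smooth_map real_line M \<beta>" "\<beta> 0 = \<one>" "Y = velocity M \<beta>"
    using assms(2) by (rule lie_algebraE)
  have "velocity M (\<lambda>t. \<alpha> t \<otimes> \<beta> t) \<in> lie_algebra G M"
    using \<alpha> \<beta> by (intro lie_algebraI smooth_map_mult charted_space_real_line) auto
  then show ?thesis using velocity_mult[OF \<alpha>(1,2) \<beta>(1,2)] \<alpha>(3) \<beta>(3) by simp
qed

lemma lie_algebra_scale:
  assumes "X \<in> lie_algebra G M"
  shows "(\<lambda>f. c * X f) \<in> lie_algebra G M"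
proof -
  obtain \<gamma> where \<gamma>: "smooth_map real_line M \<gamma>" "\<gamma> 0 = \<one>" "X = velocity M \<gamma>"
    using assms by (rule lie_algebraE)
  obtain U \<phi> where "lie_group_chart G M U \<phi>" by (rule obtain_chart_at_one)
  then interpret lie_group_chart G M U \<phi> .
  have "smooth_map real_line M (\<lambda>t. \<gamma> (c * t))"
    by (rule smooth_map_compose[OF charted_space_real_line charted_space_real_line charted_space
          smooth_map_real_line_scale \<gamma>(1)])
  then have "velocity M (\<lambda>t. \<gamma> (c * t)) \<in> lie_algebra G M" using \<gamma>(2) by (simp add: lie_algebraI)
  moreover have "velocity M (\<lambda>t. \<gamma> (c * t)) f = c * X f" for f
  proof (cases "smooth_near M \<one> f")
    case True
    have D: "((\<lambda>t. f (\<gamma> t)) has_real_derivative X f) (at (c * 0))"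
      using curve_derivative[OF \<gamma>(1,2) True] lie_algebra_expand[OF assms, of f] True \<gamma>(3) by simp
    have "((\<lambda>t. f (\<gamma> (c * t))) has_real_derivative X f * c) (at 0)"
      by (rule DERIV_chain'[where f = "\<lambda>t. c * t" and g = "\<lambda>u. f (\<gamma> u)", OF _ D]) (auto intro!: derivative_eq_intros)
    then show ?thesis using True \<gamma>(2) by (simp add: velocity_def DERIV_imp_deriv mult.commute)
  qed (simp add: velocity_def \<gamma>)
  then have "velocity M (\<lambda>t. \<gamma> (c * t)) = (\<lambda>f. c * X f)" by (rule ext)
  ultimately show ?thesis by simp
qed

end

section \<open>Powers of elements near the identity\<close>

lemma coordinatewise_convergent_subsequence:
  fixes x :: "nat \<Rightarrow> nat \<Rightarrow> real"
  assumes "\<And>k i. i < n \<Longrightarrow> \<bar>x k i\<bar> \<le> B"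
  obtains \<rho> :: "nat \<Rightarrow> nat" and l where "strict_mono \<rho>" "\<forall>i<n. (\<lambda>k. x (\<rho> k) i) \<longlonglongrightarrow> l i"
proof -
  have "\<exists>\<rho> l. strict_mono (\<rho> :: nat \<Rightarrow> nat) \<and> (\<forall>i<n. (\<lambda>k. x (\<rho> k) i) \<longlonglongrightarrow> l i)"
    using assms
  proof (induction n)
    case 0
    show ?case by (rule exI[of _ id]) (simp add: strict_mono_def)
  next
    case (Suc n)
    then obtain \<rho> l where \<rho>: "strict_mono (\<rho> :: nat \<Rightarrow> nat)" "\<forall>i<n. (\<lambda>k. x (\<rho> k) i) \<longlonglongrightarrow> l i"
      by (metis less_SucI)
    have "bounded (range (\<lambda>k. x (\<rho> k) n))"
      using Suc.prems by (auto simp: bounded_iff)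
    then obtain l' \<sigma> where \<sigma>: "strict_mono (\<sigma> :: nat \<Rightarrow> nat)" "((\<lambda>k. x (\<rho> k) n) \<circ> \<sigma>) \<longlonglongrightarrow> l'"
      using bounded_imp_convergent_subsequence by blast
    have "(\<lambda>k. x ((\<rho> \<circ> \<sigma>) k) i) \<longlonglongrightarrow> (l(n := l')) i" if "i < Suc n" for i
    proof (cases "i = n")
      case True
      then show ?thesis using \<sigma>(2) by (simp add: comp_def)
    next
      case False
      then have "(\<lambda>k. x (\<rho> k) i) \<longlonglongrightarrow> l i" using \<rho>(2) that by auto
      from LIMSEQ_subseq_LIMSEQ[OF this \<sigma>(1)] show ?thesis using False by (simp add: comp_def)
    qed
    moreover have "strict_mono (\<rho> \<circ> \<sigma>)" using \<rho>(1) \<sigma>(1) by (rule strict_mono_o)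
    ultimately show ?case by blast
  qed
  then show thesis using that by blast
qed

context lie_group_chart
begin

text \<open>
  A radius for which products satisfy the strict derivative estimate with relative error \<open>1/2\<close> and the
  coordinate box lies in the chart. Any error below 1 would keep powers of \<open>a\<close> moving away from the
  identity.
\<close>

definition good_radius :: "real \<Rightarrow> bool" where
  "good_radius r \<longleftrightarrow> r > 0 \<and>
    (\<forall>a\<in>chart_ball r. \<forall>b\<in>chart_ball r. \<forall>a'\<in>chart_ball r. \<forall>b'\<in>chart_ball r. a \<otimes> b \<in> U \<and>
      (\<Sum>j<dim. \<bar>(\<phi> (a \<otimes> b) j - \<phi> (a' \<otimes> b') j) - ((\<phi> a j - \<phi> a' j) + (\<phi> b j - \<phi> b' j))\<bar>)
        \<le> 1 / 2 * (chart_dist a a' + chart_dist b b')) \<and>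
    (\<forall>x\<in>topspace (Euclidean_space dim). (\<forall>i<dim. \<bar>x i - \<phi> \<one> i\<bar> < r) \<longrightarrow> x \<in> \<phi> ` U)"

lemma chart_ball_mono: "r \<le> r' \<Longrightarrow> chart_ball r \<subseteq> chart_ball r'"
  by (auto simp: chart_ball_def)

lemma obtain_good_radius:
  obtains r where "good_radius r"
proof -
  have half: "(1 / 2 :: real) > 0" by simp
  obtain r1 where r1: "r1 > 0"
    "\<And>a b a' b'. \<lbrakk>a \<in> chart_ball r1; b \<in> chart_ball r1; a' \<in> chart_ball r1; b' \<in> chart_ball r1\<rbrakk> \<Longrightarrow> a \<otimes> b \<in> U \<and>
      (\<Sum>j<dim. \<bar>(\<phi> (a \<otimes> b) j - \<phi> (a' \<otimes> b') j) - ((\<phi> a j - \<phi> a' j) + (\<phi> b j - \<phi> b' j))\<bar>)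
        \<le> 1 / 2 * (chart_dist a a' + chart_dist b b')"
    by (rule mult_strict_derivative[OF half]) (rule that)
  have "\<phi> \<one> \<in> \<phi> ` U" using one_in_U by blast
  then obtain r2 where r2: "r2 > 0"
    "\<forall>x\<in>topspace (Euclidean_space dim). (\<forall>i<dim. \<bar>x i - \<phi> \<one> i\<bar> < r2) \<longrightarrow> x \<in> \<phi> ` U"
    by (rule openin_Euclidean_space_box[OF open_range[OF chart]]) (rule that)
  have sub: "chart_ball (min r1 r2) \<subseteq> chart_ball r1" by (rule chart_ball_mono) simp
  have "good_radius (min r1 r2)"
    unfolding good_radius_def
  proof (intro conjI)
    show "min r1 r2 > 0" using r1 r2 by simp
    show "\<forall>x\<in>topspace (Euclidean_space dim). (\<forall>i<dim. \<bar>x i - \<phi> \<one> i\<bar> < min r1 r2) \<longrightarrow> x \<in> \<phi> ` U"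
      using r2(2) by simp
  qed (intro ballI, rule r1(2); use sub in blast)
  then show thesis by (rule that)
qed

context
  fixes r
  assumes r: "good_radius r"
begin

lemma radius_pos: "r > 0"
  using r by (simp add: good_radius_def)

lemma mult_in_U: "\<lbrakk>a \<in> chart_ball r; b \<in> chart_ball r\<rbrakk> \<Longrightarrow> a \<otimes> b \<in> U"
  using r unfolding good_radius_def by blast

lemma mult_strict:
  "\<lbrakk>a \<in> chart_ball r; b \<in> chart_ball r; a' \<in> chart_ball r; b' \<in> chart_ball r\<rbrakk> \<Longrightarrow>
    (\<Sum>j<dim. \<bar>(\<phi> (a \<otimes> b) j - \<phi> (a' \<otimes> b') j) - ((\<phi> a j - \<phi> a' j) + (\<phi> b j - \<phi> b' j))\<bar>)
        \<le> 1 / 2 * (chart_dist a a' + chart_dist b b')"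
  using r unfolding good_radius_def by blast

lemma chart_ball_carrier: "a \<in> chart_ball s \<Longrightarrow> a \<in> carrier G"
  using U_subset by (auto simp: chart_ball_def)

lemma mult_Lipschitz:
  assumes "a \<in> chart_ball r" "b \<in> chart_ball r" "a' \<in> chart_ball r" "b' \<in> chart_ball r"
  shows "chart_dist (a \<otimes> b) (a' \<otimes> b') \<le> 2 * (chart_dist a a' + chart_dist b b')"
proof -
  have "chart_dist (a \<otimes> b) (a' \<otimes> b') \<le> (\<Sum>j<dim.
      \<bar>(\<phi> (a \<otimes> b) j - \<phi> (a' \<otimes> b') j) - ((\<phi> a j - \<phi> a' j) + (\<phi> b j - \<phi> b' j))\<bar>
      + \<bar>\<phi> a j - \<phi> a' j\<bar> + \<bar>\<phi> b j - \<phi> b' j\<bar>)"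
    unfolding chart_dist_def by (rule sum_mono) linarith
  also have "\<dots> \<le> 1 / 2 * (chart_dist a a' + chart_dist b b') + chart_dist a a' + chart_dist b b'"
    using mult_strict[OF assms] by (simp add: sum.distrib chart_dist_def)
  also have "\<dots> \<le> 2 * (chart_dist a a' + chart_dist b b')"
    using chart_dist_nonneg[of a a'] chart_dist_nonneg[of b b'] by simp
  finally show ?thesis .
qed

text \<open>
  As long as the powers of \<open>a\<close> stay in the ball, each further factor moves them by the coordinate
  vector of \<open>a\<close> up to half its length. So \<open>a\<^sup>k\<close> stays within a factor two of where \<open>k\<close> times that
  vector would be, and in particular cannot return to the identity early.
\<close>

lemma power_near_multiple:
  assumes a: "a \<in> chart_ball r" and s: "2 * real m * chart_dist a \<one> < s" "s \<le> r"
  shows "k \<le> m \<Longrightarrow> a [^] k \<in> chart_ball s \<and>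
    (\<Sum>j<dim. \<bar>\<phi> (a [^] k) j - \<phi> \<one> j - real k * (\<phi> a j - \<phi> \<one> j)\<bar>) \<le> 1 / 2 * real k * chart_dist a \<one>"
proof (induction k)
  case 0
  have "s > 0" using s(1) chart_dist_nonneg[of a \<one>] by (smt (verit) mult_nonneg_nonneg of_nat_0_le_iff)
  then show ?case by (simp add: one_in_chart_ball)
next
  case (Suc k)
  let ?u = "\<lambda>k j. \<phi> (a [^] k) j - \<phi> \<one> j - real k * (\<phi> a j - \<phi> \<one> j)"
  have one: "\<one> \<in> chart_ball r" using radius_pos by (rule one_in_chart_ball)
  have ak: "a [^] k \<in> chart_ball r" using Suc chart_ball_mono[OF s(2)] by auto
  have carr: "a [^] k \<in> carrier G" "a \<in> carrier G" using chart_ball_carrier a ak by auto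
  have step: "(\<Sum>j<dim. \<bar>?u (Suc k) j - ?u k j\<bar>) \<le> 1 / 2 * chart_dist a \<one>"
  proof -
    have eq: "?u (Suc k) j - ?u k j = (\<phi> (a [^] k \<otimes> a) j - \<phi> (a [^] k \<otimes> \<one>) j)
        - ((\<phi> (a [^] k) j - \<phi> (a [^] k) j) + (\<phi> a j - \<phi> \<one> j))" for j
      using carr by (simp add: algebra_simps)
    show ?thesis using mult_strict[OF ak a ak one] by (simp only: eq chart_dist_same add_0)
  qed
  have "(\<Sum>j<dim. \<bar>?u (Suc k) j\<bar>) \<le> (\<Sum>j<dim. \<bar>?u (Suc k) j - ?u k j\<bar> + \<bar>?u k j\<bar>)"
    by (rule sum_mono) linarith
  also have "\<dots> \<le> 1 / 2 * chart_dist a \<one> + 1 / 2 * real k * chart_dist a \<one>"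
    using step Suc by (simp add: sum.distrib)
  also have "\<dots> = 1 / 2 * real (Suc k) * chart_dist a \<one>" by (simp add: algebra_simps)
  finally have u: "(\<Sum>j<dim. \<bar>?u (Suc k) j\<bar>) \<le> 1 / 2 * real (Suc k) * chart_dist a \<one>" .
  have "chart_dist (a [^] Suc k) \<one> \<le> (\<Sum>j<dim. \<bar>?u (Suc k) j\<bar> + real (Suc k) * \<bar>\<phi> a j - \<phi> \<one> j\<bar>)"
    unfolding chart_dist_def
  proof (rule sum_mono)
    fix j
    have "\<phi> (a [^] Suc k) j - \<phi> \<one> j = ?u (Suc k) j + real (Suc k) * (\<phi> a j - \<phi> \<one> j)" by simp
    then have "\<bar>\<phi> (a [^] Suc k) j - \<phi> \<one> j\<bar> \<le> \<bar>?u (Suc k) j\<bar> + \<bar>real (Suc k) * (\<phi> a j - \<phi> \<one> j)\<bar>"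
      by (metis abs_triangle_ineq)
    then show "\<bar>\<phi> (a [^] Suc k) j - \<phi> \<one> j\<bar> \<le> \<bar>?u (Suc k) j\<bar> + real (Suc k) * \<bar>\<phi> a j - \<phi> \<one> j\<bar>"
      by (simp only: abs_mult abs_of_nat)
  qed
  also have "\<dots> = (\<Sum>j<dim. \<bar>?u (Suc k) j\<bar>) + real (Suc k) * chart_dist a \<one>"
    by (simp only: sum.distrib chart_dist_def sum_distrib_left)
  also have "\<dots> \<le> 2 * (real (Suc k) * chart_dist a \<one>)"
    using u mult_nonneg_nonneg[OF of_nat_0_le_iff chart_dist_nonneg, of "Suc k" a \<one>] by linarith
  also have "\<dots> \<le> 2 * (real m * chart_dist a \<one>)"
    using Suc.prems chart_dist_nonneg[of a \<one>] by (intro mult_left_mono mult_right_mono) auto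
  also have "\<dots> < s" using s(1) by simp
  finally have "chart_dist (a [^] Suc k) \<one> < s" .
  moreover have "a [^] Suc k \<in> U" using mult_in_U[OF ak a] by simp
  ultimately show ?case using u by (simp only: chart_ball_def mem_Collect_eq simp_thms)
qed

lemma chart_dist_power_lower:
  assumes a: "a \<in> chart_ball r" and m: "2 * real m * chart_dist a \<one> < r"
  shows "1 / 2 * real m * chart_dist a \<one> \<le> chart_dist (a [^] m) \<one>"
proof -
  have "real m * chart_dist a \<one> \<le> (\<Sum>j<dim. \<bar>\<phi> (a [^] m) j - \<phi> \<one> j\<bar>
      + \<bar>\<phi> (a [^] m) j - \<phi> \<one> j - real m * (\<phi> a j - \<phi> \<one> j)\<bar>)"
    unfolding chart_dist_def sum_distrib_left
  proof (rule sum_mono)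
    fix j
    have "real m * \<bar>\<phi> a j - \<phi> \<one> j\<bar> = \<bar>real m * (\<phi> a j - \<phi> \<one> j)\<bar>" by (simp add: abs_mult)
    then show "real m * \<bar>\<phi> a j - \<phi> \<one> j\<bar> \<le> \<bar>\<phi> (a [^] m) j - \<phi> \<one> j\<bar>
      + \<bar>\<phi> (a [^] m) j - \<phi> \<one> j - real m * (\<phi> a j - \<phi> \<one> j)\<bar>" by linarith
  qed
  also have "\<dots> \<le> chart_dist (a [^] m) \<one> + 1 / 2 * real m * chart_dist a \<one>"
    using power_near_multiple[OF a m order_refl order_refl] by (simp add: sum.distrib chart_dist_def)
  finally show ?thesis by simp
qed

text \<open>
  Passing from \<open>b\<^sup>m\<close> to \<open>a\<^sup>m\<close> through the products \<open>a\<^sup>k b\<^sup>m\<^sup>-\<^sup>k\<close> replaces one factor \<open>b\<close> by \<open>a\<close> at a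
  time, and the Lipschitz estimate is used only twice in each step, however long the product is.
\<close>

lemma chart_dist_powers:
  assumes a: "a \<in> chart_ball r" "2 * real m * chart_dist a \<one> < r / 8"
    and b: "b \<in> chart_ball r" "2 * real m * chart_dist b \<one> < r / 8"
  shows "chart_dist (a [^] m) (b [^] m) \<le> 4 * real m * chart_dist a b"
proof -
  have r8: "r / 8 \<le> r" using radius_pos by simp
  have in_r: "x \<in> chart_ball r" if "x \<in> chart_ball (r / 8)" for x
    using that chart_ball_mono[OF r8] by blast
  have ak: "a [^] k \<in> chart_ball (r / 8)" and bk: "b [^] k \<in> chart_ball (r / 8)" if "k \<le> m" for k
    using power_near_multiple[OF a r8 that] power_near_multiple[OF b r8 that] by auto
  have carr: "a \<in> carrier G" "b \<in> carrier G" using a b chart_ball_carrier by auto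
  have "chart_dist (a [^] k \<otimes> b [^] (m - k)) (b [^] m) \<le> 4 * real k * chart_dist a b" if "k \<le> m" for k
    using that
  proof (induction k)
    case 0
    then show ?case using carr by (simp add: chart_dist_same)
  next
    case (Suc k)
    define l where "l = m - Suc k"
    have l: "m - k = Suc l" "l \<le> m" "Suc l \<le> m" using Suc.prems by (auto simp: l_def)
    have aU: "a \<in> chart_ball (r / 8)" using ak[of 1] Suc.prems carr by simp
    have ab: "a \<otimes> b [^] l \<in> chart_ball r"
    proof -
      have "chart_dist (a \<otimes> b [^] l) (\<one> \<otimes> \<one>) \<le> 2 * (chart_dist a \<one> + chart_dist (b [^] l) \<one>)"
        using one_in_chart_ball[OF radius_pos] in_r[OF bk[OF l(2)]] a(1) by (intro mult_Lipschitz)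
      also have "\<dots> < r" using aU bk[OF l(2)] radius_pos by (simp add: chart_ball_def)
      finally show ?thesis using mult_in_U[OF a(1) in_r[OF bk[OF l(2)]]] by (simp add: chart_ball_def)
    qed
    have bl: "b \<otimes> b [^] l = b [^] Suc l" using carr nat_pow_Suc2 by simp
    have "chart_dist (a [^] k \<otimes> (a \<otimes> b [^] l)) (a [^] k \<otimes> (b \<otimes> b [^] l))
        \<le> 2 * (chart_dist (a [^] k) (a [^] k) + chart_dist (a \<otimes> b [^] l) (b \<otimes> b [^] l))"
      using Suc.prems by (intro mult_Lipschitz ab in_r[OF ak]) (auto simp only: bl intro: in_r[OF bk[OF l(3)]])
    also have "\<dots> \<le> 2 * (2 * (chart_dist a b + chart_dist (b [^] l) (b [^] l)))"
      using mult_Lipschitz[OF a(1) in_r[OF bk[OF l(2)]] b(1) in_r[OF bk[OF l(2)]]] by (simp add: chart_dist_same)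
    also have "\<dots> = 4 * chart_dist a b" by (simp add: chart_dist_same)
    finally have "chart_dist (a [^] Suc k \<otimes> b [^] (m - Suc k)) (a [^] k \<otimes> b [^] (m - k)) \<le> 4 * chart_dist a b"
      using carr by (simp add: l(1) l_def[symmetric] bl m_assoc)
    then have "chart_dist (a [^] Suc k \<otimes> b [^] (m - Suc k)) (b [^] m) \<le> 4 * chart_dist a b + 4 * real k * chart_dist a b"
      using Suc chart_dist_triangle[of "a [^] Suc k \<otimes> b [^] (m - Suc k)" "b [^] m" "a [^] k \<otimes> b [^] (m - k)"] by simp
    then show ?case by (simp add: algebra_simps)
  qed
  from this[of m] show ?thesis using carr by simp
qed

end

text \<open>
  The difference quotient along the times \<open>c/(k+1)\<close>, scaled so that it measures \<open>k + 1\<close> copies of the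
  displacement; the power with exponent \<open>k + 1\<close> follows it.
\<close>

lemma curve_difference_quotient:
  assumes \<gamma>: "smooth_map real_line M \<gamma>" "\<gamma> 0 = \<one>" and i: "i < dim" and c: "c \<noteq> 0"
  shows "(\<lambda>k. real (Suc k) * (\<phi> (\<gamma> (c / real (Suc k))) i - \<phi> \<one> i)) \<longlonglongrightarrow> c * velocity M \<gamma> (\<lambda>p. \<phi> p i)"
proof -
  have "((\<lambda>h. (\<phi> (\<gamma> h) i - \<phi> \<one> i) / h) \<longlongrightarrow> velocity M \<gamma> (\<lambda>p. \<phi> p i)) (at 0)"
    using curve_coordinate_derivative[OF \<gamma> i] \<gamma>(2) by (simp add: has_field_derivative_iff)
  moreover have "filterlim (\<lambda>k. c / real (Suc k)) (at 0) sequentially"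
    unfolding filterlim_at using c tendsto_mult_right_zero[OF LIMSEQ_inverse_real_of_nat, of c]
    by (simp add: divide_inverse del: of_nat_Suc)
  ultimately have "(\<lambda>k. (\<phi> (\<gamma> (c / real (Suc k))) i - \<phi> \<one> i) / (c / real (Suc k))) \<longlonglongrightarrow> velocity M \<gamma> (\<lambda>p. \<phi> p i)"
    by (rule filterlim_compose)
  from tendsto_mult_left[OF this, of c]
  have "(\<lambda>k. c * ((\<phi> (\<gamma> (c / real (Suc k))) i - \<phi> \<one> i) / (c / real (Suc k)))) \<longlonglongrightarrow> c * velocity M \<gamma> (\<lambda>p. \<phi> p i)" .
  moreover have "c * (v / (c / real (Suc k))) = real (Suc k) * v" for v k using c by simp
  ultimately show ?thesis by (simp only:)
qed

lemma curve_sequentially_in_U: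
  assumes "smooth_map real_line M \<gamma>" "\<gamma> 0 = \<one>"
  shows "\<forall>\<^sub>F k in sequentially. \<gamma> (c / real (Suc k)) \<in> U"
proof -
  have "(\<lambda>k. c / real (Suc k)) \<longlonglongrightarrow> 0"
    using tendsto_mult_right_zero[OF LIMSEQ_inverse_real_of_nat, of c] by (simp add: divide_inverse del: of_nat_Suc)
  then show ?thesis
    by (rule eventually_compose_filterlim[OF curve_eventually_in_U[OF assms]])
qed

end

text \<open>
  For one curve the powers with exponent about \<open>1/t\<close> of its value at time \<open>t\<close> stay in a compact set away
  from the identity, so a subsequence converges. Two curves with the same velocity are \<open>o(t)\<close> apart, hence
  their powers \<open>o(1)\<close> apart, and the same limit serves all curves. It is a value of the one-parameter
  subgroup generated by \<open>X\<close>, and this lemma takes the place of the exponential map.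
\<close>

lemma (in lie_group) common_power_limit:
  assumes X: "X \<in> lie_algebra G M" and nz: "X \<noteq> (\<lambda>f. 0)"
  obtains x s and m :: "nat \<Rightarrow> nat" where "x \<in> carrier G" "x \<noteq> \<one>"
    "\<And>\<beta>. \<lbrakk>smooth_map real_line M \<beta>; \<beta> 0 = \<one>; velocity M \<beta> = X\<rbrakk> \<Longrightarrow>
      limitin (mtop M) (\<lambda>k. \<beta> (s k) [^] m k) x sequentially"
proof -
  obtain U \<phi> where "lie_group_chart G M U \<phi>" by (rule obtain_chart_at_one)
  then interpret lie_group_chart G M U \<phi> .
  obtain r where r: "good_radius r" by (rule obtain_good_radius)
  note r_pos = radius_pos[OF r]
  define \<xi> where "\<xi> i = X (\<lambda>p. \<phi> p i)" for i
  define S where "S = (\<Sum>i<dim. \<bar>\<xi> i\<bar>)"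
  have S: "S > 0"
  proof (rule ccontr)
    assume "\<not> S > 0"
    then have "S = 0" unfolding S_def by (meson abs_ge_zero dual_order.order_iff_strict sum_nonneg)
    then have "\<xi> i = 0" if "i < dim" for i using that by (auto simp: S_def sum_nonneg_eq_0_iff)
    then have "X f = 0" for f using lie_algebra_expand[OF X, of f] by (simp add: \<xi>_def)
    then show False using nz by auto
  qed
  \<comment> \<open>With this scale the powers end up at distance about \<open>r / 32\<close>: inside the ball where the estimates
    hold, and away from the identity.\<close>
  define c where "c = r / (32 * S)"
  have c: "c > 0" using S r_pos by (simp add: c_def)
  define t where "t k = c / real (Suc k)" for k
  define curves where "curves = {\<beta>. smooth_map real_line M \<beta> \<and> \<beta> 0 = \<one> \<and> velocity M \<beta> = X}"
  have quot: "(\<lambda>k. real (Suc k) * (\<phi> (\<beta> (t k)) i - \<phi> \<one> i)) \<longlonglongrightarrow> c * \<xi> i"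
    if "\<beta> \<in> curves" "i < dim" for \<beta> i
    using curve_difference_quotient[of \<beta> i c] that c by (auto simp: curves_def t_def \<xi>_def)
  have dist_one: "(\<lambda>k. real (Suc k) * chart_dist (\<beta> (t k)) \<one>) \<longlonglongrightarrow> r / 32" if "\<beta> \<in> curves" for \<beta>
  proof -
    have "(\<lambda>k. \<Sum>i<dim. \<bar>real (Suc k) * (\<phi> (\<beta> (t k)) i - \<phi> \<one> i)\<bar>) \<longlonglongrightarrow> (\<Sum>i<dim. \<bar>c * \<xi> i\<bar>)"
      by (intro tendsto_sum tendsto_rabs quot[OF that]) simp
    moreover have "(\<Sum>i<dim. \<bar>real (Suc k) * (\<phi> (\<beta> (t k)) i - \<phi> \<one> i)\<bar>) = real (Suc k) * chart_dist (\<beta> (t k)) \<one>" for k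
      by (simp only: abs_mult abs_of_nat chart_dist_def sum_distrib_left)
    moreover have "(\<Sum>i<dim. \<bar>c * \<xi> i\<bar>) = c * S"
      using c by (simp only: abs_mult abs_of_pos S_def sum_distrib_left)
    moreover have "c * S = r / 32" using S by (simp add: c_def)
    ultimately show ?thesis by (simp only:)
  qed
  have small: "\<forall>\<^sub>F k in sequentially. \<beta> (t k) \<in> chart_ball r \<and> 2 * real (Suc k) * chart_dist (\<beta> (t k)) \<one> < r / 8"
    if "\<beta> \<in> curves" for \<beta>
  proof -
    have "\<forall>\<^sub>F k in sequentially. real (Suc k) * chart_dist (\<beta> (t k)) \<one> < r / 16"
      using dist_one[OF that] by (rule order_tendstoD) (use r_pos in simp)
    moreover have "\<forall>\<^sub>F k in sequentially. \<beta> (t k) \<in> U"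
      using curve_sequentially_in_U[of \<beta> c] that by (simp add: curves_def t_def)
    ultimately show ?thesis
    proof eventually_elim
      case (elim k)
      have "1 * chart_dist (\<beta> (t k)) \<one> \<le> real (Suc k) * chart_dist (\<beta> (t k)) \<one>"
        using chart_dist_nonneg by (intro mult_right_mono) auto
      then have "chart_dist (\<beta> (t k)) \<one> < r" using elim r_pos by linarith
      then show ?case using elim by (simp add: chart_ball_def algebra_simps)
    qed
  qed
  obtain \<alpha> where \<alpha>: "\<alpha> \<in> curves" using X by (auto simp: curves_def elim: lie_algebraE)
  have close: "(\<lambda>k. real (Suc k) * chart_dist (\<alpha> (t k)) (\<beta> (t k))) \<longlonglongrightarrow> 0" if "\<beta> \<in> curves" for \<beta>
  proof -
    have "(\<lambda>k. \<Sum>i<dim. \<bar>real (Suc k) * (\<phi> (\<alpha> (t k)) i - \<phi> \<one> i) - real (Suc k) * (\<phi> (\<beta> (t k)) i - \<phi> \<one> i)\<bar>)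
        \<longlonglongrightarrow> (\<Sum>i<dim. \<bar>c * \<xi> i - c * \<xi> i\<bar>)"
      by (intro tendsto_sum tendsto_rabs tendsto_diff quot[OF that] quot[OF \<alpha>]) simp_all
    moreover have "\<bar>real (Suc k) * (\<phi> (\<alpha> (t k)) i - \<phi> \<one> i) - real (Suc k) * (\<phi> (\<beta> (t k)) i - \<phi> \<one> i)\<bar>
        = real (Suc k) * \<bar>\<phi> (\<alpha> (t k)) i - \<phi> (\<beta> (t k)) i\<bar>" for k i
      unfolding right_diff_distrib[symmetric] abs_mult by simp
    ultimately show ?thesis by (simp add: chart_dist_def sum_distrib_left del: of_nat_Suc)
  qed
  obtain K where K: "\<And>k. k \<ge> K \<Longrightarrow> \<alpha> (t k) \<in> chart_ball r \<and> 2 * real (Suc k) * chart_dist (\<alpha> (t k)) \<one> < r / 8"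
    using small[OF \<alpha>] unfolding eventually_sequentially by blast
  define y where "y k = \<alpha> (t k) [^] Suc k" for k
  have y: "y k \<in> chart_ball (r / 8)" if "k \<ge> K" for k
    unfolding y_def using power_near_multiple[OF r _ _ _ order_refl, of "\<alpha> (t k)" "Suc k" "r / 8"] K[OF that] r_pos by simp
  have bound: "\<bar>\<phi> (y (k + K)) i\<bar> \<le> (\<Sum>i<dim. \<bar>\<phi> \<one> i\<bar>) + r" if "i < dim" for k i
  proof -
    have "\<bar>\<phi> (y (k + K)) i - \<phi> \<one> i\<bar> < r"
      using coordinate_le_chart_dist[OF that, of "y (k + K)" \<one>] y[of "k + K"] r_pos by (simp add: chart_ball_def)
    moreover have "\<bar>\<phi> \<one> i\<bar> \<le> (\<Sum>i<dim. \<bar>\<phi> \<one> i\<bar>)" using that by (intro member_le_sum) auto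
    ultimately show ?thesis by linarith
  qed
  obtain \<rho> :: "nat \<Rightarrow> nat" and l where \<rho>: "strict_mono \<rho>"
    and lim: "\<forall>i<dim. (\<lambda>k. \<phi> (y (\<rho> k + K)) i) \<longlonglongrightarrow> l i"
    using coordinatewise_convergent_subsequence[where x = "\<lambda>k. \<phi> (y (k + K))", OF bound] by metis
  define m where "m k = \<rho> k + K" for k
  have m: "filterlim m sequentially sequentially"
    unfolding m_def by (rule filterlim_subseq) (use \<rho> in \<open>simp add: strict_mono_def\<close>)
  define z where "z = (\<lambda>i. if i < dim then l i else 0)"
  have z: "z \<in> topspace (Euclidean_space dim)" by (auto simp: z_def topspace_Euclidean_space)
  have "\<bar>z i - \<phi> \<one> i\<bar> < r" if "i < dim" for i
  proof -
    have "(\<lambda>k. \<bar>\<phi> (y (m k)) i - \<phi> \<one> i\<bar>) \<longlonglongrightarrow> \<bar>l i - \<phi> \<one> i\<bar>"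
      using lim that unfolding m_def by (intro tendsto_intros) auto
    moreover have "\<bar>\<phi> (y (m k)) i - \<phi> \<one> i\<bar> \<le> r / 8" for k
      using coordinate_le_chart_dist[OF that, of "y (m k)" \<one>] y[of "m k"] by (simp add: chart_ball_def m_def)
    ultimately have "\<bar>l i - \<phi> \<one> i\<bar> \<le> r / 8"
      by (intro tendsto_upperbound[where F = sequentially]) auto
    then show ?thesis using that r_pos by (simp add: z_def)
  qed
  then have "z \<in> \<phi> ` U" using r z unfolding good_radius_def by blast
  then obtain x where x: "x \<in> U" "z = \<phi> x" by blast
  have \<phi>x: "\<phi> x i = l i" if "i < dim" for i using x(2) that by (metis z_def)
  have "chart_dist x \<one> \<ge> r / 64"
  proof (rule tendsto_lowerbound[where F = sequentially])
    \<comment> \<open>The power estimate bounds \<open>chart_dist (y k) \<one>\<close> below by half a quantity that tends to \<open>r / 32\<close>;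
      the correcting terms turn this into a bound by a constant.\<close>
    have "(\<lambda>k. 2 * chart_dist (y (m k)) \<one> - real (Suc (m k)) * chart_dist (\<alpha> (t (m k))) \<one> + r / 32)
        \<longlonglongrightarrow> 2 * chart_dist x \<one> - r / 32 + r / 32"
      unfolding chart_dist_def[of "y _"] chart_dist_def[of x]
      using lim \<phi>x by (intro tendsto_intros filterlim_compose[OF dist_one[OF \<alpha>] m]) (auto simp: m_def)
    then show "(\<lambda>k. (2 * chart_dist (y (m k)) \<one> - real (Suc (m k)) * chart_dist (\<alpha> (t (m k))) \<one> + r / 32) / 2) \<longlonglongrightarrow> chart_dist x \<one>"
      using tendsto_divide[OF _ tendsto_const, of _ "2 * chart_dist x \<one>" sequentially 2] by simp
    have "1 / 2 * real (Suc (m k)) * chart_dist (\<alpha> (t (m k))) \<one> \<le> chart_dist (y (m k)) \<one>" for k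
      unfolding y_def using K[of "m k"] r_pos by (intro chart_dist_power_lower[OF r]) (auto simp: m_def)
    then show "\<forall>\<^sub>F k in sequentially. r / 64 \<le> (2 * chart_dist (y (m k)) \<one> - real (Suc (m k)) * chart_dist (\<alpha> (t (m k))) \<one> + r / 32) / 2"
      by (intro always_eventually allI) (simp add: field_simps del: of_nat_Suc)
  qed simp
  then have "x \<noteq> \<one>" using r_pos chart_dist_same[of \<one>] by auto
  moreover have "limitin (mtop M) (\<lambda>k. \<beta> (t (m k)) [^] Suc (m k)) x sequentially" if \<beta>: "\<beta> \<in> curves" for \<beta>
  proof -
    define w where "w k = \<beta> (t k) [^] Suc k" for k
    have w: "\<forall>\<^sub>F k in sequentially. w k \<in> U"
      using small[OF \<beta>]
    proof eventually_elim
      case (elim k)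
      then show ?case unfolding w_def
        using power_near_multiple[OF r _ _ _ order_refl, of "\<beta> (t k)" "Suc k" "r / 8"] r_pos by (simp add: chart_ball_def)
    qed
    have "(\<lambda>k. chart_dist (y k) (w k)) \<longlonglongrightarrow> 0"
    proof (rule tendsto_sandwich[OF _ _ tendsto_const])
      show "\<forall>\<^sub>F k in sequentially. chart_dist (y k) (w k) \<le> 4 * (real (Suc k) * chart_dist (\<alpha> (t k)) (\<beta> (t k)))"
        using small[OF \<beta>] small[OF \<alpha>]
      proof eventually_elim
        case (elim k)
        then show ?case unfolding w_def y_def using chart_dist_powers[OF r, of "\<alpha> (t k)" "Suc k" "\<beta> (t k)"]
          by (simp only: mult.assoc)
      qed
      show "(\<lambda>k. 4 * (real (Suc k) * chart_dist (\<alpha> (t k)) (\<beta> (t k)))) \<longlonglongrightarrow> 0"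
        by (rule tendsto_mult_right_zero[OF close[OF \<beta>]])
    qed (auto simp: chart_dist_nonneg)
    then have yw: "(\<lambda>k. chart_dist (y (m k)) (w (m k))) \<longlonglongrightarrow> 0" using m by (rule filterlim_compose)
    have wl: "(\<lambda>k. \<phi> (w (m k)) i) \<longlonglongrightarrow> \<phi> x i" if i: "i < dim" for i
    proof -
      have "(\<lambda>k. \<phi> (w (m k)) i - \<phi> (y (m k)) i) \<longlonglongrightarrow> 0"
      proof (rule tendsto_rabs_zero_cancel, rule tendsto_sandwich[OF _ _ tendsto_const yw])
        show "\<forall>\<^sub>F k in sequentially. \<bar>\<phi> (w (m k)) i - \<phi> (y (m k)) i\<bar> \<le> chart_dist (y (m k)) (w (m k))"
          by (intro always_eventually allI) (subst abs_minus_commute, rule coordinate_le_chart_dist[OF i])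
      qed auto
      moreover have "(\<lambda>k. \<phi> (y (m k)) i) \<longlonglongrightarrow> \<phi> x i" using lim i \<phi>x by (simp add: m_def)
      ultimately show ?thesis using tendsto_add by fastforce
    qed
    have wU: "\<forall>\<^sub>F k in sequentially. w (m k) \<in> U" by (rule eventually_compose_filterlim[OF w m])
    have "limitin (Euclidean_space dim) (\<lambda>k. \<phi> (w (m k))) (\<phi> x) sequentially"
    proof (rule limitin_Euclidean_space)
      show "\<forall>\<^sub>F k in sequentially. \<phi> (w (m k)) \<in> topspace (Euclidean_space dim)"
        using wU by eventually_elim (rule chart_in_Euclidean_space[OF chart])
    qed (use wl chart_in_Euclidean_space[OF chart x(1)] in auto)
    moreover have "\<forall>\<^sub>F k in sequentially. \<phi> (w (m k)) \<in> \<phi> ` U" using wU by eventually_elim simp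
    ultimately have "limitin (subtopology (Euclidean_space dim) (\<phi> ` U)) (\<lambda>k. \<phi> (w (m k))) (\<phi> x) sequentially"
      using x(1) by (simp add: limitin_subtopology)
    from continuous_map_limit[OF continuous_inv_chart[OF chart] this]
    have "limitin (mtop M) (\<lambda>k. inv_into U \<phi> (\<phi> (w (m k)))) x sequentially"
      using inv_chart[OF chart x(1)] by (simp add: limitin_subtopology comp_def)
    moreover have "\<forall>\<^sub>F k in sequentially. inv_into U \<phi> (\<phi> (w (m k))) = w (m k)"
      using wU by eventually_elim (rule inv_chart[OF chart])
    ultimately have "limitin (mtop M) (\<lambda>k. w (m k)) x sequentially"
      by (rule limitin_transform_eventually[rotated])
    then show ?thesis by (simp only: w_def)
  qed
  moreover have "x \<in> carrier G" using x(1) U_subset by blast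
  ultimately show thesis
    using that[of x "\<lambda>k. t (m k)" "\<lambda>k. Suc (m k)"] by (simp only: curves_def mem_Collect_eq simp_thms)
qed

section \<open>Norms on finite-dimensional spaces of functionals\<close>

locale functional_space =
  fixes V :: "('a \<Rightarrow> real) set"
  assumes zero: "(\<lambda>f. 0) \<in> V"
    and add: "\<lbrakk>X \<in> V; Y \<in> V\<rbrakk> \<Longrightarrow> (\<lambda>f. X f + Y f) \<in> V"
    and scale: "X \<in> V \<Longrightarrow> (\<lambda>f. c * X f) \<in> V"
begin

lemma linear_combination: "(\<And>i. i < n \<Longrightarrow> b i \<in> V) \<Longrightarrow> (\<lambda>f. \<Sum>i<n. c i * b i f) \<in> V" for n :: nat
proof (induction n)
  case 0
  then show ?case by (simp add: zero)
next
  case (Suc n)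
  then show ?case using add[OF Suc.IH scale[of "b n" "c n"]] by simp
qed

lemma diff: "\<lbrakk>X \<in> V; Y \<in> V\<rbrakk> \<Longrightarrow> (\<lambda>f. X f - Y f) \<in> V"
  using add[of X "\<lambda>f. (- 1) * Y f"] scale[of Y "- 1"] by simp

end

text \<open>
  Evaluations at \<open>e\<^sub>0, \<dots>, e\<^sub>n\<^sub>-\<^sub>1\<close> that separate the points of \<open>V\<close> may satisfy linear relations on \<open>V\<close>, so the
  \<open>b\<^sub>i\<close> need not be a basis; they span \<open>V\<close> with the evaluations as coefficients. Limits of
  coefficient vectors are therefore again coefficients of elements of \<open>V\<close>.
\<close>

lemma dual_family:
  fixes n :: nat
  assumes "functional_space V" "\<And>X. \<lbrakk>X \<in> V; \<And>i. i < n \<Longrightarrow> X (e i) = 0\<rbrakk> \<Longrightarrow> X = (\<lambda>f. 0)"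
  shows "\<exists>b. (\<forall>i<n. b i \<in> V) \<and> (\<forall>X\<in>V. \<forall>f. X f = (\<Sum>i<n. X (e i) * b i f))"
  using assms
proof (induction n arbitrary: V)
  case 0
  have "X f = 0" if "X \<in> V" for X f using "0.prems"(2)[OF that] by simp
  then show ?case by auto
next
  case (Suc n)
  interpret functional_space V by fact
  define V' where "V' = {X \<in> V. X (e n) = 0}"
  have "functional_space V'"
    by unfold_locales (auto simp: V'_def zero add scale)
  moreover have "X = (\<lambda>f. 0)" if "X \<in> V'" "\<And>i. i < n \<Longrightarrow> X (e i) = 0" for X
    using Suc.prems(2)[of X] that by (auto simp: V'_def less_Suc_eq)
  ultimately have "\<exists>b. (\<forall>i<n. b i \<in> V') \<and> (\<forall>X\<in>V'. \<forall>f. X f = (\<Sum>i<n. X (e i) * b i f))"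
    by (rule Suc.IH)
  then obtain b where b: "\<forall>i<n. b i \<in> V'" "\<forall>X\<in>V'. \<forall>f. X f = (\<Sum>i<n. X (e i) * b i f)"
    by (elim exE conjE) (rule that)
  show ?case
  proof (cases "V' = V")
    case True
    have "X f = (\<Sum>i<Suc n. X (e i) * (b(n := \<lambda>f. 0)) i f)" if "X \<in> V" for X f
      using b(2) that[folded True] by simp
    moreover have "\<forall>i<Suc n. (b(n := \<lambda>f. 0)) i \<in> V"
      using b(1) zero by (auto simp: less_Suc_eq V'_def)
    ultimately show ?thesis by blast
  next
    case False
    then obtain Y where Y: "Y \<in> V" "Y (e n) \<noteq> 0" unfolding V'_def by blast
    define Z where "Z f = inverse (Y (e n)) * Y f" for f
    have Z: "Z \<in> V" "Z (e n) = 1" using scale[OF Y(1)] Y(2) by (auto simp: Z_def[abs_def])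
    \<comment> \<open>Splitting off \<open>X (e n) Z\<close> changes the coefficients of the other \<open>b i\<close>; this choice of the last
      vector restores them to \<open>X (e i)\<close>.\<close>
    define b' where "b' = b(n := \<lambda>f. Z f - (\<Sum>i<n. Z (e i) * b i f))"
    have "(\<lambda>f. \<Sum>i<n. Z (e i) * b i f) \<in> V"
      using b(1) by (intro linear_combination) (simp add: V'_def)
    then have "\<forall>i<Suc n. b' i \<in> V"
      using b(1) diff[OF Z(1)] by (auto simp: b'_def less_Suc_eq V'_def)
    moreover have "X f = (\<Sum>i<Suc n. X (e i) * b' i f)" if X: "X \<in> V" for X f
    proof -
      have "(\<lambda>f. X f - X (e n) * Z f) \<in> V'"
        using diff[OF X scale[OF Z(1)]] Z(2) by (simp add: V'_def)
      from b(2)[THEN bspec, OF this]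
      have "X f - X (e n) * Z f = (\<Sum>i<n. (X (e i) - X (e n) * Z (e i)) * b i f)" by (rule spec)
      then have "X f = X (e n) * Z f + (\<Sum>i<n. X (e i) * b i f - X (e n) * (Z (e i) * b i f))"
        by (simp add: left_diff_distrib mult.assoc)
      also have "\<dots> = (\<Sum>i<n. X (e i) * b i f) + X (e n) * (Z f - (\<Sum>i<n. Z (e i) * b i f))"
        by (simp add: sum_subtractf sum_distrib_left right_diff_distrib)
      also have "\<dots> = (\<Sum>i<Suc n. X (e i) * b' i f)" by (simp add: b'_def)
      finally show ?thesis .
    qed
    ultimately show ?thesis by blast
  qed
qed

locale functional_space_seminorm = functional_space V for V :: "('a \<Rightarrow> real) set" +
  fixes e :: "nat \<Rightarrow> 'a" and n :: nat and p :: "('a \<Rightarrow> real) \<Rightarrow> real"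
  assumes separating: "\<lbrakk>X \<in> V; \<And>i. i < n \<Longrightarrow> X (e i) = 0\<rbrakk> \<Longrightarrow> X = (\<lambda>f. 0)"
    and triangle: "\<lbrakk>X \<in> V; Y \<in> V\<rbrakk> \<Longrightarrow> p (\<lambda>f. X f + Y f) \<le> p X + p Y"
    and homogeneous: "X \<in> V \<Longrightarrow> p (\<lambda>f. c * X f) = \<bar>c\<bar> * p X"
begin

lemma spanning_family: "\<exists>b. (\<forall>i<n. b i \<in> V) \<and> (\<forall>X\<in>V. \<forall>f. X f = (\<Sum>i<n. X (e i) * b i f))"
  by (rule dual_family[OF functional_space_axioms]) (rule separating)

lemma seminorm_nonneg:
  assumes "X \<in> V"
  shows "p X \<ge> 0"
proof -
  have "p (\<lambda>f. X f + (- 1) * X f) \<le> p X + p (\<lambda>f. (- 1) * X f)"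
    by (rule triangle[OF assms scale[OF assms]])
  moreover have "p (\<lambda>f. 0 * X f) = \<bar>0\<bar> * p X" by (rule homogeneous[OF assms])
  ultimately show ?thesis using homogeneous[OF assms, of "- 1"] by simp
qed

lemma seminorm_linear_combination:
  "(\<And>i. i < k \<Longrightarrow> b i \<in> V) \<Longrightarrow> p (\<lambda>f. \<Sum>i<k. c i * b i f) \<le> (\<Sum>i<k. \<bar>c i\<bar> * p (b i))" for k :: nat
proof (induction k)
  case 0
  show ?case using homogeneous[OF zero, of 0] by simp
next
  case (Suc k)
  have "p (\<lambda>f. (\<Sum>i<k. c i * b i f) + c k * b k f) \<le> p (\<lambda>f. \<Sum>i<k. c i * b i f) + p (\<lambda>f. c k * b k f)"
    using Suc.prems by (intro triangle linear_combination scale) auto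
  also have "\<dots> \<le> (\<Sum>i<k. \<bar>c i\<bar> * p (b i)) + \<bar>c k\<bar> * p (b k)"
    using Suc by (intro add_mono) (auto simp: homogeneous)
  finally show ?case by simp
qed

lemma seminorm_le_coordinates:
  "\<exists>C\<ge>0. \<forall>X\<in>V. p X \<le> C * (\<Sum>i<n. \<bar>X (e i)\<bar>)"
proof -
  obtain b where b: "\<forall>i<n. b i \<in> V" "\<forall>X\<in>V. \<forall>f. X f = (\<Sum>i<n. X (e i) * b i f)"
    using spanning_family by (elim exE conjE) (rule that)
  define C where "C = (\<Sum>i<n. p (b i))"
  have p_b: "p (b i) \<le> C" if "i < n" for i
    unfolding C_def using that b(1) by (intro member_le_sum) (auto intro: seminorm_nonneg)
  show ?thesis
  proof (intro exI conjI ballI)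
    show "C \<ge> 0" unfolding C_def using b(1) by (intro sum_nonneg) (auto intro: seminorm_nonneg)
    fix X assume X: "X \<in> V"
    have "X = (\<lambda>f. \<Sum>i<n. X (e i) * b i f)" using b(2) X by blast
    then have "p X = p (\<lambda>f. \<Sum>i<n. X (e i) * b i f)" by (rule arg_cong)
    also have "\<dots> \<le> (\<Sum>i<n. \<bar>X (e i)\<bar> * p (b i))" by (rule seminorm_linear_combination) (use b in blast)
    also have "\<dots> \<le> (\<Sum>i<n. \<bar>X (e i)\<bar> * C)" using p_b by (intro sum_mono mult_left_mono) auto
    finally show "p X \<le> C * (\<Sum>i<n. \<bar>X (e i)\<bar>)" by (simp add: sum_distrib_left mult.commute)
  qed
qed

text \<open>
  Otherwise some vectors with coordinate sum 1 have \<open>p\<close> tending to 0,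
  and a limit of them, which exists by compactness of the coordinate sphere, is a nonzero vector with \<open>p = 0\<close>.
\<close>

lemma coordinates_le_norm:
  assumes definite: "\<And>X. \<lbrakk>X \<in> V; p X = 0\<rbrakk> \<Longrightarrow> X = (\<lambda>f. 0)"
  shows "\<exists>C. \<forall>X\<in>V. (\<Sum>i<n. \<bar>X (e i)\<bar>) \<le> C * p X"
proof (rule ccontr)
  assume contra: "\<nexists>C. \<forall>X\<in>V. (\<Sum>i<n. \<bar>X (e i)\<bar>) \<le> C * p X"
  define N where "N X = (\<Sum>i<n. \<bar>X (e i)\<bar>)" for X :: "'a \<Rightarrow> real"
  have N_nonneg: "N X \<ge> 0" for X by (simp add: N_def sum_nonneg)
  have "\<exists>X\<in>V. real (Suc k) * p X < N X" for k
    using contra unfolding N_def by (meson not_le)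
  then obtain X where X: "\<And>k. X k \<in> V" "\<And>k. real (Suc k) * p (X k) < N (X k)" by metis
  have N_pos: "N (X k) > 0" for k
    using X(2)[of k] mult_nonneg_nonneg[OF of_nat_0_le_iff seminorm_nonneg[OF X(1)], of "Suc k" k] by linarith
  define Y where "Y k f = inverse (N (X k)) * X k f" for k f
  have Y: "Y k \<in> V" for k unfolding Y_def by (rule scale[OF X(1)])
  have NY: "N (Y k) = 1" for k
  proof -
    have "N (Y k) = \<bar>inverse (N (X k))\<bar> * N (X k)"
      unfolding N_def[of "Y k"] N_def[of "X k"] Y_def by (simp add: abs_mult sum_distrib_left)
    then show ?thesis using N_pos[of k] by simp
  qed
  have pY: "p (Y k) \<le> inverse (real (Suc k))" for k
  proof -
    have "p (Y k) = inverse (N (X k)) * p (X k)"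
      unfolding Y_def homogeneous[OF X(1)] using N_pos[of k] by simp
    also have "\<dots> \<le> inverse (N (X k)) * (N (X k) / real (Suc k))"
      using X(2)[of k] N_pos[of k]
      by (intro mult_left_mono) (auto simp: pos_le_divide_eq mult.commute less_imp_le simp del: of_nat_Suc)
    also have "\<dots> = inverse (real (Suc k))" using N_pos[of k] by (simp add: divide_inverse del: of_nat_Suc)
    finally show ?thesis .
  qed
  have bound: "\<bar>Y k (e i)\<bar> \<le> 1" if "i < n" for k i
  proof -
    have "\<bar>Y k (e i)\<bar> \<le> N (Y k)" unfolding N_def using that by (intro member_le_sum) auto
    then show ?thesis by (simp add: NY)
  qed
  obtain \<rho> :: "nat \<Rightarrow> nat" and l where \<rho>: "strict_mono \<rho>" and lim: "\<forall>i<n. (\<lambda>k. Y (\<rho> k) (e i)) \<longlonglongrightarrow> l i"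
    using coordinatewise_convergent_subsequence[where x = "\<lambda>k i. Y k (e i)", OF bound] by metis
  obtain b where b: "\<forall>i<n. b i \<in> V" "\<forall>X\<in>V. \<forall>f. X f = (\<Sum>i<n. X (e i) * b i f)"
    using spanning_family by (elim exE conjE) (rule that)
  define Z where "Z f = (\<Sum>i<n. l i * b i f)" for f
  have Z: "Z \<in> V" unfolding Z_def using b(1) by (intro linear_combination) blast
  have Z_coordinate: "Z (e j) = l j" if "j < n" for j
  proof (rule LIMSEQ_unique)
    have "(\<lambda>k. \<Sum>i<n. Y (\<rho> k) (e i) * b i (e j)) \<longlonglongrightarrow> Z (e j)"
      unfolding Z_def using lim by (intro tendsto_sum tendsto_mult tendsto_const) auto
    moreover have "(\<Sum>i<n. Y (\<rho> k) (e i) * b i (e j)) = Y (\<rho> k) (e j)" for k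
      by (rule sym, rule b(2)[THEN bspec, OF Y, THEN spec])
    ultimately show "(\<lambda>k. Y (\<rho> k) (e j)) \<longlonglongrightarrow> Z (e j)" by simp
  qed (use lim that in blast)
  have "(\<lambda>k. N (Y (\<rho> k))) \<longlonglongrightarrow> N Z"
    unfolding N_def using lim by (intro tendsto_sum tendsto_rabs) (auto simp: Z_coordinate)
  then have NZ: "N Z = 1" using LIMSEQ_unique[of "\<lambda>k. N (Y (\<rho> k))" "N Z" 1] by (simp add: NY)
  obtain C where C: "C \<ge> 0" "\<forall>X\<in>V. p X \<le> C * N X"
    unfolding N_def using seminorm_le_coordinates by blast
  have "p Z \<le> 0"
  proof (rule tendsto_lowerbound[where F = sequentially])
    have "(\<lambda>k. inverse (real (Suc (\<rho> k)))) \<longlonglongrightarrow> 0"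
      using LIMSEQ_subseq_LIMSEQ[OF LIMSEQ_inverse_real_of_nat \<rho>] by (simp add: comp_def)
    moreover have "(\<lambda>k. \<Sum>i<n. \<bar>l i - Y (\<rho> k) (e i)\<bar>) \<longlonglongrightarrow> (\<Sum>i<n. \<bar>l i - l i\<bar>)"
      using lim by (intro tendsto_sum tendsto_rabs tendsto_diff tendsto_const) auto
    ultimately have "(\<lambda>k. inverse (real (Suc (\<rho> k))) + C * (\<Sum>i<n. \<bar>l i - Y (\<rho> k) (e i)\<bar>)) \<longlonglongrightarrow> 0 + C * (\<Sum>i<n. \<bar>l i - l i\<bar>)"
      by (intro tendsto_add tendsto_mult tendsto_const)
    then show "(\<lambda>k. inverse (real (Suc (\<rho> k))) + C * (\<Sum>i<n. \<bar>l i - Y (\<rho> k) (e i)\<bar>)) \<longlonglongrightarrow> 0" by simp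
    have "p Z \<le> inverse (real (Suc (\<rho> k))) + C * (\<Sum>i<n. \<bar>l i - Y (\<rho> k) (e i)\<bar>)" for k
    proof -
      have "p (\<lambda>f. Y (\<rho> k) f + (Z f - Y (\<rho> k) f)) \<le> p (Y (\<rho> k)) + p (\<lambda>f. Z f - Y (\<rho> k) f)"
        by (rule triangle[OF Y diff[OF Z Y]])
      also have "\<dots> \<le> inverse (real (Suc (\<rho> k))) + C * N (\<lambda>f. Z f - Y (\<rho> k) f)"
        by (rule add_mono[OF pY C(2)[THEN bspec, OF diff[OF Z Y]]])
      also have "N (\<lambda>f. Z f - Y (\<rho> k) f) = (\<Sum>i<n. \<bar>l i - Y (\<rho> k) (e i)\<bar>)"
        unfolding N_def by (intro sum.cong) (auto simp: Z_coordinate)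
      finally show ?thesis by simp
    qed
    then show "\<forall>\<^sub>F k in sequentially. p Z \<le> inverse (real (Suc (\<rho> k))) + C * (\<Sum>i<n. \<bar>l i - Y (\<rho> k) (e i)\<bar>)"
      by simp
  qed simp
  then have "Z = (\<lambda>f. 0)" using definite[OF Z] seminorm_nonneg[OF Z] by simp
  then show False using NZ by (simp add: N_def)
qed

end

section \<open>Bounded vectors\<close>

context lie_group
begin

text \<open>
  The powers of a curve in \<open>g\<inverse> H g\<close> stay in \<open>g\<inverse> H g\<close>. So the element obtained from \<open>X\<close> lies
  in all conjugates of \<open>H\<close>, hence fixes every coset.
\<close>

lemma no_vector_with_all_conjugates_in_isotropy:
  assumes H: "subgroup H G" and closed: "closedin (mtop M) H" and effective: "acts_effectively G H"
    and X: "X \<in> lie_algebra G M" and conj: "\<And>g. g \<in> carrier G \<Longrightarrow> Ad G M g X \<in> lie_subalgebra G M H"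
  shows "X = (\<lambda>f. 0)"
proof (rule ccontr)
  assume "X \<noteq> (\<lambda>f. 0)"
  then obtain x s and m :: "nat \<Rightarrow> nat" where x: "x \<in> carrier G" "x \<noteq> \<one>" and lim:
    "\<And>\<beta>. \<lbrakk>smooth_map real_line M \<beta>; \<beta> 0 = \<one>; velocity M \<beta> = X\<rbrakk> \<Longrightarrow>
      limitin (mtop M) (\<lambda>k. \<beta> (s k) [^] m k) x sequentially"
    using common_power_limit[OF X] by metis
  have in_conjugate: "g \<otimes> x \<otimes> inv g \<in> H" if g: "g \<in> carrier G" for g
  proof -
    obtain \<gamma> where \<gamma>: "Ad G M g X = velocity M \<gamma>" "smooth_map real_line M \<gamma>" "\<gamma> 0 = \<one>" "range \<gamma> \<subseteq> H"
      using conj[OF g] unfolding lie_subalgebra_def by blast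
    define \<beta> where "\<beta> t = inv g \<otimes> \<gamma> t \<otimes> inv (inv g)" for t
    have \<beta>: "smooth_map real_line M \<beta>" "\<beta> 0 = \<one>"
      unfolding \<beta>_def using smooth_curve_conj[OF inv_closed[OF g] \<gamma>(2)] g \<gamma>(3) by auto
    have "velocity M \<beta> = Ad G M (inv g) (Ad G M g X)"
      using Ad_velocity[OF inv_closed[OF g] \<gamma>(2,3)] by (simp add: \<gamma>(1) \<beta>_def[abs_def])
    then have "velocity M \<beta> = X" using Ad_mult[OF inv_closed[OF g] g X] Ad_one[OF X] g by simp
    note lim = lim[OF \<beta> this]
    define K where "K = {y \<in> carrier G. g \<otimes> y \<otimes> inv g \<in> H}"
    have K_mult: "y \<otimes> z \<in> K" if "y \<in> K" "z \<in> K" for y z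
    proof -
      have yz: "y \<in> carrier G" "z \<in> carrier G" using that by (auto simp: K_def)
      have "(g \<otimes> y \<otimes> inv g) \<otimes> (g \<otimes> z \<otimes> inv g) = g \<otimes> y \<otimes> (inv g \<otimes> g) \<otimes> z \<otimes> inv g"
        using yz g by (simp only: m_assoc m_closed inv_closed)
      also have "\<dots> = g \<otimes> (y \<otimes> z) \<otimes> inv g" using yz g by (simp add: m_assoc)
      finally show ?thesis
        using that yz subgroup.m_closed[OF H] unfolding K_def by (metis (mono_tags, lifting) m_closed mem_Collect_eq)
    qed
    have K_one: "\<one> \<in> K" using g subgroup.one_closed[OF H] by (simp add: K_def)
    have "\<beta> t \<in> K" for t
    proof -
      have c: "\<gamma> t \<in> carrier G" using curve_in_carrier[OF \<gamma>(2)] .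
      have "g \<otimes> \<beta> t \<otimes> inv g = (g \<otimes> inv g) \<otimes> \<gamma> t \<otimes> (g \<otimes> inv g)"
        unfolding \<beta>_def using c g by (simp only: m_assoc m_closed inv_closed inv_inv)
      then show ?thesis using c g \<gamma>(4) curve_in_carrier[OF \<beta>(1)] by (auto simp: K_def)
    qed
    then have "\<beta> t [^] k \<in> K" for t and k :: nat
      by (induction k) (simp_all add: K_one K_mult)
    moreover have "closedin (mtop M) K"
      using closedin_continuous_map_preimage[OF smooth_map_continuous[OF smooth_map_conj[OF g]] closed]
      by (simp add: K_def carrier_eq)
    ultimately have "x \<in> K" using limitin_closedin[OF lim] by simp
    then show ?thesis by (simp add: K_def)
  qed
  have fixes_cosets: "x <# C = \<one> <# C" if C: "C \<in> lcosets H" for C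
  proof -
    obtain g where g: "g \<in> carrier G" "C = g <# H" using C by (auto simp: LCOSETS_def)
    have h: "inv g \<otimes> x \<otimes> g \<in> H" using in_conjugate[OF inv_closed[OF g(1)]] g(1) by simp
    have sub: "H \<subseteq> carrier G" by (rule subgroup.subset[OF H])
    have "x \<otimes> g = g \<otimes> (inv g \<otimes> x \<otimes> g)" using g x by (simp add: m_assoc[symmetric])
    then have "x <# C = g <# ((inv g \<otimes> x \<otimes> g) <# H)"
      using g x sub by (simp add: lcos_m_assoc)
    also have "(inv g \<otimes> x \<otimes> g) <# H = H" using coset_join3[OF _ H h] g x by simp
    finally show ?thesis using g sub by (simp add: lcos_mult_one lcos_m_assoc)
  qed
  have "inj_on (\<lambda>g. \<lambda>C\<in>lcosets H. g <# C) (carrier G)"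
    using effective unfolding acts_effectively_def faithful_action_def faithful_action_axioms_def by blast
  moreover have "(\<lambda>C\<in>lcosets H. x <# C) = (\<lambda>C\<in>lcosets H. \<one> <# C)"
    using fixes_cosets by (intro restrict_ext)
  ultimately show False using x by (meson inj_onD one_closed)
qed

end

text \<open>
  The group \<open>G\<close> acts effectively on \<open>G/H\<close>, and \<open>\<nu>\<close> is a norm on the tangent space \<open>\<g>/\<h>\<close> at the base
  point. The theorem compares two such situations that share \<open>G\<close>.
\<close>

locale isotropy_norm = lie_group +
  fixes H :: "'a set" and \<nu> :: "'a tangent_vector set \<Rightarrow> real"
  assumes H: "subgroup H G" and closed: "closedin (mtop M) H" and effective: "acts_effectively G H"
    and \<nu>: "quotient_norm G M H \<nu>"
begin

abbreviation q :: "'a tangent_vector \<Rightarrow> real" where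
  "q X \<equiv> \<nu> (quotient_proj G M H X)"

lemma q_nonneg: "X \<in> lie_algebra G M \<Longrightarrow> q X \<ge> 0"
  using \<nu> unfolding quotient_norm_def by blast

lemma q_scale: "X \<in> lie_algebra G M \<Longrightarrow> q (\<lambda>f. c * X f) = \<bar>c\<bar> * q X"
  using \<nu> unfolding quotient_norm_def by blast

lemma q_add: "\<lbrakk>X \<in> lie_algebra G M; Y \<in> lie_algebra G M\<rbrakk> \<Longrightarrow> q (\<lambda>f. X f + Y f) \<le> q X + q Y"
  using \<nu> unfolding quotient_norm_def by blast

lemma q_eq_0:
  assumes "X \<in> lie_algebra G M" "q X = 0"
  shows "X \<in> lie_subalgebra G M H"
proof -
  have "quotient_proj G M H X = quotient_proj G M H (\<lambda>f. 0)"
    using \<nu> assms unfolding quotient_norm_def by blast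
  moreover have "(\<lambda>f. X f + 0) \<in> quotient_proj G M H X"
    unfolding quotient_proj_def using zero_in_lie_subalgebra[OF subgroup.one_closed[OF H]]
    by (intro CollectI exI[of _ "\<lambda>f. 0"] conjI refl)
  ultimately show ?thesis unfolding quotient_proj_def by auto
qed

lemma functional_space_lie_algebra: "functional_space (lie_algebra G M)"
proof
  show "(\<lambda>f. 0) \<in> lie_algebra G M"
    using zero_in_lie_subalgebra[of "carrier G"]
    by (auto simp: lie_subalgebra_def intro: lie_algebraI)
qed (simp_all add: lie_algebra_add lie_algebra_scale)

text \<open>
  Meant for bounded vectors, on which the supremum is finite. Unlike \<open>q\<close> it is invariant under the
  adjoint action and takes the value 0 only at 0.
\<close>

definition orbit_norm :: "'a tangent_vector \<Rightarrow> real" where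
  "orbit_norm X = (SUP g\<in>carrier G. q (Ad G M g X))"

lemma bounded_vectors_lie_algebra: "X \<in> bounded_vectors G M H \<nu> \<Longrightarrow> X \<in> lie_algebra G M"
  by (simp add: bounded_vectors_def)

lemma bounded_vectorsI:
  assumes "X \<in> lie_algebra G M" "\<And>g. g \<in> carrier G \<Longrightarrow> q (Ad G M g X) \<le> B"
  shows "X \<in> bounded_vectors G M H \<nu>"
  unfolding bounded_vectors_def bounded_iff
  using assms q_nonneg Ad_in_lie_algebra by (auto intro!: exI[of _ B])

lemma orbit_norm_upper:
  assumes X: "X \<in> bounded_vectors G M H \<nu>" and g: "g \<in> carrier G"
  shows "q (Ad G M g X) \<le> orbit_norm X"
  unfolding orbit_norm_def
proof (rule cSUP_upper[OF g])
  show "bdd_above ((\<lambda>g. q (Ad G M g X)) ` carrier G)"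
    using X by (simp add: bounded_vectors_def bounded_imp_bdd_above)
qed

lemma orbit_norm_least: "(\<And>g. g \<in> carrier G \<Longrightarrow> q (Ad G M g X) \<le> B) \<Longrightarrow> orbit_norm X \<le> B"
  unfolding orbit_norm_def by (rule cSUP_least) auto

lemma bounded_vectors_add:
  assumes "X \<in> bounded_vectors G M H \<nu>" "Y \<in> bounded_vectors G M H \<nu>"
  shows "(\<lambda>f. X f + Y f) \<in> bounded_vectors G M H \<nu>" "orbit_norm (\<lambda>f. X f + Y f) \<le> orbit_norm X + orbit_norm Y"
proof -
  have le: "q (Ad G M g (\<lambda>f. X f + Y f)) \<le> orbit_norm X + orbit_norm Y" if g: "g \<in> carrier G" for g
  proof -
    have "q (Ad G M g (\<lambda>f. X f + Y f)) \<le> q (Ad G M g X) + q (Ad G M g Y)"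
      unfolding Ad_add using assms g by (intro q_add Ad_in_lie_algebra bounded_vectors_lie_algebra)
    also have "\<dots> \<le> orbit_norm X + orbit_norm Y" using assms g by (intro add_mono orbit_norm_upper)
    finally show ?thesis .
  qed
  show "(\<lambda>f. X f + Y f) \<in> bounded_vectors G M H \<nu>"
    by (rule bounded_vectorsI[OF lie_algebra_add[OF assms[THEN bounded_vectors_lie_algebra]] le])
  show "orbit_norm (\<lambda>f. X f + Y f) \<le> orbit_norm X + orbit_norm Y" using le by (rule orbit_norm_least)
qed

lemma bounded_vectors_scale:
  assumes "X \<in> bounded_vectors G M H \<nu>"
  shows "(\<lambda>f. c * X f) \<in> bounded_vectors G M H \<nu>" "orbit_norm (\<lambda>f. c * X f) = \<bar>c\<bar> * orbit_norm X"
proof -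
  have eq: "q (Ad G M g (\<lambda>f. c * Z f)) = \<bar>c\<bar> * q (Ad G M g Z)"
    if "g \<in> carrier G" "Z \<in> bounded_vectors G M H \<nu>" for g c Z
    unfolding Ad_scale using that by (intro q_scale Ad_in_lie_algebra bounded_vectors_lie_algebra)
  have mem: "(\<lambda>f. c * X f) \<in> bounded_vectors G M H \<nu>" for c
  proof (rule bounded_vectorsI)
    show "q (Ad G M g (\<lambda>f. c * X f)) \<le> \<bar>c\<bar> * orbit_norm X" if "g \<in> carrier G" for g
      unfolding eq[OF that assms] using assms that by (intro mult_left_mono orbit_norm_upper) auto
  qed (simp add: assms bounded_vectors_lie_algebra lie_algebra_scale)
  have le: "orbit_norm (\<lambda>f. c * Z f) \<le> \<bar>c\<bar> * orbit_norm Z" if Z: "Z \<in> bounded_vectors G M H \<nu>" for c Z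
  proof (rule orbit_norm_least)
    show "q (Ad G M g (\<lambda>f. c * Z f)) \<le> \<bar>c\<bar> * orbit_norm Z" if "g \<in> carrier G" for g
      unfolding eq[OF that Z] using Z that by (intro mult_left_mono orbit_norm_upper) auto
  qed
  show "(\<lambda>f. c * X f) \<in> bounded_vectors G M H \<nu>" by (rule mem)
  show "orbit_norm (\<lambda>f. c * X f) = \<bar>c\<bar> * orbit_norm X"
  proof (cases "c = 0")
    case True
    have "q (Ad G M g (\<lambda>f. 0 * X f)) = 0" if "g \<in> carrier G" for g using eq[OF that assms, of 0] by simp
    then have "orbit_norm (\<lambda>f. 0 * X f) = (SUP g\<in>carrier G. 0)"
      unfolding orbit_norm_def by (intro SUP_cong refl)
    also have "\<dots> = 0" using one_closed by (intro cSUP_const) blast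
    finally have "orbit_norm (\<lambda>f. 0 * X f) = 0" .
    then show ?thesis using True by simp
  next
    case False
    then have "(\<lambda>f. inverse c * (c * X f)) = X" by auto
    with le[OF mem[of c], of "inverse c"] have "orbit_norm X \<le> \<bar>inverse c\<bar> * orbit_norm (\<lambda>f. c * X f)" by simp
    then have "\<bar>c\<bar> * orbit_norm X \<le> orbit_norm (\<lambda>f. c * X f)" using False by (simp add: field_simps)
    then show ?thesis using le[OF assms, of c] by simp
  qed
qed

text \<open>
  Here effectiveness enters: if the orbit norm of \<open>X\<close> is 0, the whole adjoint orbit of \<open>X\<close> lies in \<open>\<h>\<close>.
\<close>

lemma orbit_norm_eq_0:
  assumes "X \<in> bounded_vectors G M H \<nu>" "orbit_norm X = 0"
  shows "X = (\<lambda>f. 0)"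
proof (rule no_vector_with_all_conjugates_in_isotropy[OF H closed effective])
  show X: "X \<in> lie_algebra G M" using assms(1) by (rule bounded_vectors_lie_algebra)
  fix g assume g: "g \<in> carrier G"
  then have "q (Ad G M g X) \<le> 0" using orbit_norm_upper[OF assms(1)] assms(2) by metis
  then show "Ad G M g X \<in> lie_subalgebra G M H"
    using q_eq_0[OF Ad_in_lie_algebra[OF g X]] q_nonneg[OF Ad_in_lie_algebra[OF g X]] by simp
qed

lemma Ad_bounded_vectors:
  assumes X: "X \<in> bounded_vectors G M H \<nu>" and g: "g \<in> carrier G"
  shows "Ad G M g X \<in> bounded_vectors G M H \<nu>" "orbit_norm (Ad G M g X) \<le> orbit_norm X"
proof -
  have le: "q (Ad G M h (Ad G M g X)) \<le> orbit_norm X" if "h \<in> carrier G" for h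
    using that g X orbit_norm_upper[OF X] by (simp add: Ad_mult bounded_vectors_lie_algebra)
  show "Ad G M g X \<in> bounded_vectors G M H \<nu>"
    using le by (rule bounded_vectorsI[OF Ad_in_lie_algebra[OF g bounded_vectors_lie_algebra[OF X]]])
  show "orbit_norm (Ad G M g X) \<le> orbit_norm X" using le by (rule orbit_norm_least)
qed

text \<open>
  On the finite-dimensional space of bounded vectors the orbit norm is a norm that the adjoint action does
  not increase, so it bounds the coordinates along an orbit. Conversely any seminorm on the Lie algebra is
  bounded by the coordinates.
\<close>

lemma bounded_vectors_iff_orbit_bounded:
  assumes chart: "lie_group_chart G M U \<phi>" and X: "X \<in> lie_algebra G M"
  shows "X \<in> bounded_vectors G M H \<nu> \<longleftrightarrow>
    (\<exists>B. \<forall>g\<in>carrier G. (\<Sum>i<mdim M. \<bar>Ad G M g X (\<lambda>p. \<phi> p i)\<bar>) \<le> B)"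
proof -
  interpret chart: lie_group_chart G M U \<phi> by fact
  interpret \<g>: functional_space "lie_algebra G M" by (rule functional_space_lie_algebra)
  have separating: "X = (\<lambda>f. 0)" if "X \<in> lie_algebra G M" "\<And>i. i < mdim M \<Longrightarrow> X (\<lambda>p. \<phi> p i) = 0" for X
    by (rule chart.lie_algebra_eqI[OF that(1) \<g>.zero]) (simp add: that(2))
  show ?thesis
  proof
    assume bounded: "X \<in> bounded_vectors G M H \<nu>"
    interpret functional_space_seminorm "bounded_vectors G M H \<nu>" "\<lambda>i p. \<phi> p i" "mdim M" orbit_norm
    proof
      show "(\<lambda>f. 0) \<in> bounded_vectors G M H \<nu>" using bounded_vectors_scale(1)[OF bounded, of 0] by simp
    qed (simp_all add: bounded_vectors_add bounded_vectors_scale separating bounded_vectors_lie_algebra)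
    obtain C where C: "\<forall>Y\<in>bounded_vectors G M H \<nu>. (\<Sum>i<mdim M. \<bar>Y (\<lambda>p. \<phi> p i)\<bar>) \<le> C * orbit_norm Y"
      using coordinates_le_norm[OF orbit_norm_eq_0] by blast
    have "(\<Sum>i<mdim M. \<bar>Ad G M g X (\<lambda>p. \<phi> p i)\<bar>) \<le> \<bar>C\<bar> * orbit_norm X" if g: "g \<in> carrier G" for g
    proof -
      have "(\<Sum>i<mdim M. \<bar>Ad G M g X (\<lambda>p. \<phi> p i)\<bar>) \<le> C * orbit_norm (Ad G M g X)"
        using C Ad_bounded_vectors(1)[OF bounded g] by blast
      also have "\<dots> \<le> \<bar>C\<bar> * orbit_norm (Ad G M g X)"
        using seminorm_nonneg[OF Ad_bounded_vectors(1)[OF bounded g]] by (intro mult_right_mono) auto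
      also have "\<dots> \<le> \<bar>C\<bar> * orbit_norm X"
        using Ad_bounded_vectors(2)[OF bounded g] by (intro mult_left_mono) auto
      finally show ?thesis .
    qed
    then show "\<exists>B. \<forall>g\<in>carrier G. (\<Sum>i<mdim M. \<bar>Ad G M g X (\<lambda>p. \<phi> p i)\<bar>) \<le> B" by blast
  next
    assume "\<exists>B. \<forall>g\<in>carrier G. (\<Sum>i<mdim M. \<bar>Ad G M g X (\<lambda>p. \<phi> p i)\<bar>) \<le> B"
    then obtain B where B: "\<And>g. g \<in> carrier G \<Longrightarrow> (\<Sum>i<mdim M. \<bar>Ad G M g X (\<lambda>p. \<phi> p i)\<bar>) \<le> B" by blast
    interpret functional_space_seminorm "lie_algebra G M" "\<lambda>i p. \<phi> p i" "mdim M" q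
      by unfold_locales (simp_all add: separating q_add q_scale)
    obtain C where C: "C \<ge> 0" "\<forall>Y\<in>lie_algebra G M. q Y \<le> C * (\<Sum>i<mdim M. \<bar>Y (\<lambda>p. \<phi> p i)\<bar>)"
      using seminorm_le_coordinates by blast
    show "X \<in> bounded_vectors G M H \<nu>"
    proof (rule bounded_vectorsI[OF X])
      fix g assume g: "g \<in> carrier G"
      show "q (Ad G M g X) \<le> C * B"
        using C(2)[THEN bspec, OF Ad_in_lie_algebra[OF g X]] mult_left_mono[OF B[OF g] C(1)] by linarith
    qed
  qed
qed

end

section \<open>Independence of the isotropy group\<close>

theorem theorem1p6:
  fixes G :: "('g, 'z) monoid_scheme" and M :: "'g manifold"
    and H1 H2 :: "'g set" and N1 N2 :: "'g set manifold"
    and m1 m2 :: "'g set metric_tensor"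
    and \<nu>1 \<nu>2 :: "'g tangent_vector set \<Rightarrow> real"
  assumes "lie_group G M" and "connected_space (mtop M)"
    and "riemannian_homogeneous_space G M H1 N1 m1" and "acts_effectively G H1"
    and "riemannian_homogeneous_space G M H2 N2 m2" and "acts_effectively G H2"
    and "quotient_norm G M H1 \<nu>1" and "quotient_norm G M H2 \<nu>2"
  shows "\<forall>X\<in>lie_algebra G M. X \<in> bounded_vectors G M H1 \<nu>1 \<longleftrightarrow> X \<in> bounded_vectors G M H2 \<nu>2"
proof -
  interpret lie_group G M by fact
  interpret H1: isotropy_norm G M H1 \<nu>1
    using assms unfolding riemannian_homogeneous_space_def
    by (intro isotropy_norm.intro isotropy_norm_axioms.intro) blast+
  interpret H2: isotropy_norm G M H2 \<nu>2
    using assms unfolding riemannian_homogeneous_space_def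
    by (intro isotropy_norm.intro isotropy_norm_axioms.intro) blast+
  obtain U \<phi> where chart: "lie_group_chart G M U \<phi>" by (rule obtain_chart_at_one)
  show ?thesis
    by (simp add: H1.bounded_vectors_iff_orbit_bounded[OF chart] H2.bounded_vectors_iff_orbit_bounded[OF chart])
qed

end
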